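(* Let $n\geq 2$ and let $d\geq 2$ be an integer. For any partition $p=(p_1,\ldots,p_m)$ of $n$, any permutation matrix $\Pi$ of size $m$, and any $s\in\mathbb{C}^n$ the mapping $f:\mathbb{C}^n\rightarrow\mathbb{C}^n$ defined through $$ f: x\mapsto x+\left((U(p,\Pi)\odot H_{n,d}(s))\,x\right)^d $$ has unit Jacobian and is polynomially invertible. The inverse mapping is given by the finite Newton's inverse $\nu_{\rm fin}(f)$ and $\mathfrak{N}(f)=m$.
   Context: The $d$-th power of a vector is taken componentwise: $(\xi_1,\ldots,\xi_n)^d=(\xi_1^d,\ldots,\xi_n^d)$. $\odot$ denotes the Hadamard (entrywise) product of matrices. "Unit Jacobian" means that the Jacobian determinant is identically equal to $1$. A partition of $n$ is a vector $(p_1,\ldots,p_m)$ of positive integers with $p_1+\ldots+p_m=n$ and $p_1\leq\ldots\leq p_m$. For $a=(a_1,\ldots,a_\ell)\in\mathbb{C}^\ell$, $S_{k\ell}[a]$ is the $k\times\ell$ matrix all of whose rows equal $(a_1,\ldots,a_\ell)$. $Z_{k\ell}[a]$ is, for $\ell\geq2$, the $k\times\ell$ matrix all of whose rows equal $(a_1,\ldots,a_{\ell-1},-a_1-\ldots-a_{\ell-1})$, and for $\ell=1$ it is the zero column. Put $B_{k\ell}^{0}[a]:=Z_{k\ell}[a]$ and $B_{k\ell}^{1}[a]:=S_{k\ell}[a]$. $\tau_m$ is the $m\times m$ strictly lower triangular matrix all of whose entries below the main diagonal equal $1$ ($\tau_1=0$). For a partition $p=(p_1,\ldots,p_m)$ of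 $n$ and a permutation matrix $\Pi$ of size $m$, put $\eta=(\eta_{jk})=\Pi\,\tau_m\,\Pi^T$; then $U(p,\Pi)$ is the $n\times n$ block matrix whose $(j,k)$ block, $1\leq j,k\leq m$, is the $p_j\times p_k$ matrix $B_{p_jp_k}^{\eta_{jk}}[a^{(j,k)}]$, where $a^{(j,k)}\in\mathbb{C}^{p_k}$ are arbitrary parameters. For $s=(s_1,\ldots,s_n)$, $H_{n,d}(s)$ is the $n\times n$ matrix whose $(j,k)$ entry is $\left(\prod_{i\neq j}s_i\right)s_k^d$. Newton's iterations: for an $n\times n$ matrix $A$ and a univariate analytic function $\varphi$ (acting on vectors componentwise) put $\nu_0={\rm Id}$ and $\nu_j(f)=\nu_j[A,\varphi](f):=f-\varphi(A\nu_{j-1}(f))$, $j=1,2,3,\ldots$, where $f=(f_1,\ldots,f_n)\in\mathbb{C}^n$. If there is $k\in\mathbb{N}$ such that $\nu_j=\nu_k$ for all $j\geq k$, then $\nu_{\rm fin}(f)=\nu_{\rm fin}[A,\varphi](f):=\nu_k$ is called the finite Newton's inverse of the mapping $f=x+\varphi(Ax)$, and the smallest such $k$ is called the Newton order of the inverse mapping to $f$, denoted $\mathfrak{N}(f)=\mathfrak{N}(A,\varphi)$; if no such $k$ exists, $\mathfrak{N}(A,\varphi)=\infty$. Here they are applied with $A=U(p,\Pi)\odot H_{n,d}(s)$ and $\varphi(\zeta)=\zeta^d$.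
   Formalization: The order equals m not for all parameters (s=0 gives the identity, of order 0): proved is order ≤ m always, with equality iff an explicit nondegeneracy condition on p, Π, d, s, a holds; for p≠(1,…,1) and all s_i≠0 it holds for an open dense set of parameters a. *)

theory Defs
  imports "HOL-Analysis.Analysis" "Jordan_Normal_Form.Determinant" "HOL-Library.Extended_Nat"
begin

(* Points of C^n are elements of carrier_vec n, indexed from 0; "vec" and "mat" below are those of
   Jordan_Normal_Form, not the type-indexed ones of HOL-Analysis. *)
no_notation vec_nth (infixl "$" 90)

section \<open>Newton's iterations\<close>

definition newton_map :: "complex Matrix.mat \<Rightarrow> (complex \<Rightarrow> complex) \<Rightarrow> complex Matrix.vec \<Rightarrow> complex Matrix.vec"
  where "newton_map A \<phi> x = x + map_vec \<phi> (A *\<^sub>v x)"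

primrec newton_iter ::
  "complex Matrix.mat \<Rightarrow> (complex \<Rightarrow> complex) \<Rightarrow> nat \<Rightarrow> complex Matrix.vec \<Rightarrow> complex Matrix.vec"
  where
    "newton_iter A \<phi> 0 y = y"
  | "newton_iter A \<phi> (Suc j) y = y - map_vec \<phi> (A *\<^sub>v newton_iter A \<phi> j y)"

definition newton_stable :: "complex Matrix.mat \<Rightarrow> (complex \<Rightarrow> complex) \<Rightarrow> nat \<Rightarrow> bool" where
  "newton_stable A \<phi> k \<longleftrightarrow>
     (\<forall>j\<ge>k. \<forall>y\<in>carrier_vec (dim_row A). newton_iter A \<phi> j y = newton_iter A \<phi> k y)"

definition newton_order :: "complex Matrix.mat \<Rightarrow> (complex \<Rightarrow> complex) \<Rightarrow> enat" where
  "newton_order A \<phi> =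
     (if \<exists>k. newton_stable A \<phi> k then enat (LEAST k. newton_stable A \<phi> k) else \<infinity>)"

(* Only meaningful if the Newton order is finite. *)
definition newton_fin ::
  "complex Matrix.mat \<Rightarrow> (complex \<Rightarrow> complex) \<Rightarrow> complex Matrix.vec \<Rightarrow> complex Matrix.vec" where
  "newton_fin A \<phi> = newton_iter A \<phi> (LEAST k. newton_stable A \<phi> k)"


section \<open>Polynomial maps, inverses, Jacobians\<close>

definition polynomial_fun :: "nat \<Rightarrow> (complex Matrix.vec \<Rightarrow> complex) \<Rightarrow> bool" where
  "polynomial_fun n g \<longleftrightarrow>
     (\<exists>(E :: (nat \<Rightarrow> nat) set) c. finite E \<and>
        (\<forall>x\<in>carrier_vec n. g x = (\<Sum>e\<in>E. c e * (\<Prod>i<n. (x $ i) ^ e i))))"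

definition polynomial_map :: "nat \<Rightarrow> (complex Matrix.vec \<Rightarrow> complex Matrix.vec) \<Rightarrow> bool" where
  "polynomial_map n g \<longleftrightarrow>
     g \<in> carrier_vec n \<rightarrow> carrier_vec n \<and> (\<forall>i<n. polynomial_fun n (\<lambda>x. g x $ i))"

definition inverse_maps ::
  "nat \<Rightarrow> (complex Matrix.vec \<Rightarrow> complex Matrix.vec) \<Rightarrow> (complex Matrix.vec \<Rightarrow> complex Matrix.vec) \<Rightarrow> bool"
  where
  "inverse_maps n f g \<longleftrightarrow>
     f \<in> carrier_vec n \<rightarrow> carrier_vec n \<and> g \<in> carrier_vec n \<rightarrow> carrier_vec n \<and>
     (\<forall>x\<in>carrier_vec n. g (f x) = x) \<and> (\<forall>y\<in>carrier_vec n. f (g y) = y)"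

definition polynomially_invertible :: "nat \<Rightarrow> (complex Matrix.vec \<Rightarrow> complex Matrix.vec) \<Rightarrow> bool" where
  "polynomially_invertible n f \<longleftrightarrow> (\<exists>g. polynomial_map n g \<and> inverse_maps n f g)"

definition jacobian_matrix ::
  "nat \<Rightarrow> (complex Matrix.vec \<Rightarrow> complex Matrix.vec) \<Rightarrow> complex Matrix.vec \<Rightarrow> complex Matrix.mat" where
  "jacobian_matrix n f x =
     Matrix.mat n n (\<lambda>(i, k). deriv (\<lambda>t. f (x + t \<cdot>\<^sub>v unit_vec n k) $ i) 0)"

definition unit_jacobian :: "nat \<Rightarrow> (complex Matrix.vec \<Rightarrow> complex Matrix.vec) \<Rightarrow> bool" where
  "unit_jacobian n f \<longleftrightarrow> (\<forall>x\<in>carrier_vec n. Determinant.det (jacobian_matrix n f x) = 1)"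


section \<open>The matrices\<close>

definition is_partition :: "nat list \<Rightarrow> nat \<Rightarrow> bool" where
  "is_partition p n \<longleftrightarrow> (\<forall>q\<in>set p. 0 < q) \<and> sum_list p = n \<and> sorted p"

definition permutation_matrix :: "nat \<Rightarrow> int Matrix.mat \<Rightarrow> bool" where
  "permutation_matrix m P \<longleftrightarrow>
     (\<exists>\<pi>. \<pi> permutes {..<m} \<and> P = Matrix.mat m m (\<lambda>(j, k). if j = \<pi> k then 1 else 0))"

definition hadamard :: "'a::times Matrix.mat \<Rightarrow> 'a Matrix.mat \<Rightarrow> 'a Matrix.mat" (infixl "\<odot>" 70) where
  "A \<odot> B = Matrix.mat (dim_row A) (dim_col A) (\<lambda>(i, j). A $$ (i, j) * B $$ (i, j))"

(* A parameter vector in C^l is a function nat => complex of which only the values below l are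
   used. For l = 1 the sum in Z_mat is empty, which gives the zero column. *)
definition S_mat :: "nat \<Rightarrow> nat \<Rightarrow> (nat \<Rightarrow> complex) \<Rightarrow> complex Matrix.mat" where
  "S_mat k l a = Matrix.mat k l (\<lambda>(i, j). a j)"

definition Z_mat :: "nat \<Rightarrow> nat \<Rightarrow> (nat \<Rightarrow> complex) \<Rightarrow> complex Matrix.mat" where
  "Z_mat k l a = Matrix.mat k l (\<lambda>(i, j). if j < l - 1 then a j else - (\<Sum>t<l - 1. a t))"

definition B_mat :: "int \<Rightarrow> nat \<Rightarrow> nat \<Rightarrow> (nat \<Rightarrow> complex) \<Rightarrow> complex Matrix.mat" where
  "B_mat e k l a = (if e = 0 then Z_mat k l a else S_mat k l a)"

definition tau_mat :: "nat \<Rightarrow> int Matrix.mat" where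
  "tau_mat m = Matrix.mat m m (\<lambda>(j, k). if k < j then 1 else 0)"

definition eta_mat :: "nat \<Rightarrow> int Matrix.mat \<Rightarrow> int Matrix.mat" where
  "eta_mat m P = P * tau_mat m * transpose_mat P"

definition block_start :: "nat list \<Rightarrow> nat \<Rightarrow> nat" where
  "block_start p j = sum_list (take j p)"

definition block_of :: "nat list \<Rightarrow> nat \<Rightarrow> nat" where
  "block_of p i = (LEAST j. i < block_start p (Suc j))"

(* a j k is the parameter vector of the (j, k) block. *)
definition U_mat :: "nat list \<Rightarrow> int Matrix.mat \<Rightarrow> (nat \<Rightarrow> nat \<Rightarrow> nat \<Rightarrow> complex) \<Rightarrow> complex Matrix.mat" where
  "U_mat p P a = Matrix.mat (sum_list p) (sum_list p) (\<lambda>(r, c).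
     let j = block_of p r; k = block_of p c in
       B_mat (eta_mat (length p) P $$ (j, k)) (p ! j) (p ! k) (a j k)
         $$ (r - block_start p j, c - block_start p k))"

definition H_mat :: "nat \<Rightarrow> nat \<Rightarrow> complex Matrix.vec \<Rightarrow> complex Matrix.mat" where
  "H_mat n d s = Matrix.mat n n (\<lambda>(j, k). (\<Prod>i\<in>{..<n} - {j}. s $ i) * (s $ k) ^ d)"


section \<open>Nondegenerate parameters\<close>

(* The Newton order of x + (A x)^d, A = U_mat p P a \<odot> H_mat n d s, drops below the number of
   parts for special parameter values (for a = 0 or s = 0 the map is the identity). Order the
   blocks by "k precedes j" iff the (j, k) entry of eta is 1. Nothing is lost iff the rows of A
   in the first block do not all vanish, no s_i vanishes (which matters only if there are at
   least two blocks), and for every block j with immediate predecessor k the entries of the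
   parameter vector a j k have nonzero sum. The first condition fails for all a and s if
   p = (1, ..., 1). *)
definition nondegenerate ::
  "nat list \<Rightarrow> int Matrix.mat \<Rightarrow> nat \<Rightarrow> complex Matrix.vec \<Rightarrow> (nat \<Rightarrow> nat \<Rightarrow> nat \<Rightarrow> complex) \<Rightarrow> bool" where
  "nondegenerate p P d s a \<longleftrightarrow>
     (let n = sum_list p; m = length p; \<eta> = eta_mat m P; A = U_mat p P a \<odot> H_mat n d s in
       (\<exists>r<n. (\<forall>k<m. \<eta> $$ (block_of p r, k) = 0) \<and> Matrix.row A r \<noteq> 0\<^sub>v n) \<and>
       (2 \<le> m \<longrightarrow> (\<forall>i<n. s $ i \<noteq> 0)) \<and>
       (\<forall>j<m. \<forall>k<m. \<eta> $$ (j, k) = 1 \<and> \<not> (\<exists>l<m. \<eta> $$ (j, l) = 1 \<and> \<eta> $$ (l, k) = 1) \<longrightarrow>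
          (\<Sum>t<p ! k. a j k t) \<noteq> 0))"

end

theory Submission
  imports Defs "Jordan_Normal_Form.Char_Poly"
begin

text \<open>All rows of \<open>U\<close> in one block agree, and \<open>s\<^sub>r \<Prod>\<^bsub>i\<noteq>r\<^esub> s\<^sub>i\<close> does not depend on \<open>r\<close>. Hence
  \<open>(A x)\<^sub>r = h\<^sub>r L\<^sub>j(x)\<close> with one linear form \<open>L\<^sub>j\<close> per block, and \<open>L\<^sub>j\<close> maps \<open>(A x)\<^sup>d\<close> to
  \<open>\<Sum>\<^sub>k W\<^sub>j\<^sub>k L\<^sub>k(x)\<^sup>d\<close>, where \<open>W\<^sub>j\<^sub>k\<close> is a multiple of a block row sum and so vanishes unless
  \<open>\<eta>\<^sub>j\<^sub>k = 1\<close>. Numbering the blocks by the order \<open>\<eta>\<close>, the \<open>i\<close>-th form of Newton's iterates is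
  stationary from step \<open>i\<close> on, and the iterates themselves are stationary from step \<open>m\<close> on.

  The last step is nontrivial iff the increment survives along the chain of blocks: the lowest form
  and all \<open>W\<^bsub>i+1,i\<^esub>\<close> have to be nonzero. No cancellation occurs along a generic line
  \<open>\<tau> v\<close> with \<open>\<tau> \<rightarrow> 0\<close>.\<close>

section \<open>Determinants of unipotent matrices\<close>

text \<open>Over the complex numbers the characteristic polynomial splits; as all its roots are 0,
  it is X^n. Its value at -1 is (-1)^n, but also the determinant of -(1 + M).\<close>

lemma det_one_plus_of_eigenvalues_zero:
  fixes M :: "complex Matrix.mat"
  assumes M: "M \<in> carrier_mat n n"
    and ev: "\<And>v k. v \<in> carrier_vec n \<Longrightarrow> M *\<^sub>v v = k \<cdot>\<^sub>v v \<Longrightarrow> v \<noteq> 0\<^sub>v n \<Longrightarrow> k = 0"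
  shows "Determinant.det (1\<^sub>m n + M) = 1"
proof -
  obtain as where as: "char_poly M = (\<Prod>a\<leftarrow>as. [:- a, 1:])" "length as = n"
    using char_poly_factorized[OF M] by blast
  have zero: "a = 0" if "a \<in> set as" for a
  proof -
    have "poly (char_poly M) a = 0"
      using that unfolding as(1) by (rule linear_poly_root)
    then have "eigenvalue M a"
      using eigenvalue_root_char_poly[OF M] by simp
    then show "a = 0"
      using ev M unfolding eigenvalue_def eigenvector_def by auto
  qed
  have "as = replicate n 0"
    using zero as(2) by (metis replicate_eqI)
  then have cp: "char_poly M = [:0, 1:] ^ n"
    by (simp add: as(1) map_replicate)
  have "- char_matrix M (- 1) = (- 1) \<cdot>\<^sub>m (1\<^sub>m n + M)"
    using M by (intro eq_matI) (auto simp: char_matrix_def)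
  then have "poly (char_poly M) (- 1) = (- 1) ^ n * Determinant.det (1\<^sub>m n + M)"
    using M by (simp add: char_poly_matrix[OF M])
  then show ?thesis
    by (simp add: cp)
qed

section \<open>Polynomial functions\<close>

lemma polynomial_fun_cong:
  assumes "\<And>x. x \<in> carrier_vec n \<Longrightarrow> f x = g x" "polynomial_fun n g"
  shows "polynomial_fun n f"
  using assms unfolding polynomial_fun_def by simp

lemma polynomial_fun_monomial: "polynomial_fun n (\<lambda>x. c * (\<Prod>i<n. (x $ i) ^ e i))"
  unfolding polynomial_fun_def by (rule exI[of _ "{e}"], rule exI[of _ "\<lambda>_. c"]) simp

lemma polynomial_fun_add:
  assumes "polynomial_fun n f" "polynomial_fun n g"
  shows "polynomial_fun n (\<lambda>x. f x + g x)"
proof -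
  obtain E c where E: "finite E"
    "\<And>x. x \<in> carrier_vec n \<Longrightarrow> f x = (\<Sum>e\<in>E. c e * (\<Prod>i<n. (x $ i) ^ e i))"
    using assms(1) unfolding polynomial_fun_def by blast
  obtain F b where F: "finite F"
    "\<And>x. x \<in> carrier_vec n \<Longrightarrow> g x = (\<Sum>e\<in>F. b e * (\<Prod>i<n. (x $ i) ^ e i))"
    using assms(2) unfolding polynomial_fun_def by blast
  \<comment> \<open>The exponent sets may overlap, so both coefficient functions are extended by
    zero to the union and added there.\<close>
  let ?c = "\<lambda>e. (if e \<in> E then c e else 0) + (if e \<in> F then b e else 0)"
  have "f x + g x = (\<Sum>e\<in>E \<union> F. ?c e * (\<Prod>i<n. (x $ i) ^ e i))" if "x \<in> carrier_vec n" for x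
  proof -
    have "f x = (\<Sum>e\<in>E \<union> F. (if e \<in> E then c e else 0) * (\<Prod>i<n. (x $ i) ^ e i))"
      unfolding E(2)[OF that] using E(1) F(1) by (intro sum.mono_neutral_cong_left) auto
    moreover have "g x = (\<Sum>e\<in>E \<union> F. (if e \<in> F then b e else 0) * (\<Prod>i<n. (x $ i) ^ e i))"
      unfolding F(2)[OF that] using E(1) F(1) by (intro sum.mono_neutral_cong_left) auto
    ultimately show ?thesis
      by (simp add: sum.distrib distrib_right)
  qed
  then show ?thesis
    unfolding polynomial_fun_def using E(1) F(1)
    by (intro exI[of _ "E \<union> F"] exI[of _ ?c]) blast
qed

lemma polynomial_fun_const: "polynomial_fun n (\<lambda>x. c)"
  using polynomial_fun_monomial[of n c "\<lambda>_. 0"] by simp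

lemma polynomial_fun_sum:
  assumes "\<And>i. i \<in> I \<Longrightarrow> polynomial_fun n (f i)"
  shows "polynomial_fun n (\<lambda>x. \<Sum>i\<in>I. f i x)"
  using assms
  by (induction I rule: infinite_finite_induct)
    (auto intro: polynomial_fun_add polynomial_fun_const[of n 0])

lemma polynomial_fun_mult:
  assumes "polynomial_fun n f" "polynomial_fun n g"
  shows "polynomial_fun n (\<lambda>x. f x * g x)"
proof -
  obtain E c where E: "finite E"
    "\<And>x. x \<in> carrier_vec n \<Longrightarrow> f x = (\<Sum>e\<in>E. c e * (\<Prod>i<n. (x $ i) ^ e i))"
    using assms(1) unfolding polynomial_fun_def by blast
  obtain F b where F: "finite F"
    "\<And>x. x \<in> carrier_vec n \<Longrightarrow> g x = (\<Sum>e\<in>F. b e * (\<Prod>i<n. (x $ i) ^ e i))"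
    using assms(2) unfolding polynomial_fun_def by blast
  \<comment> \<open>Different pairs of exponents may have the same sum, so the double sum is not yet
    in normal form; closure under sums does the collecting.\<close>
  have "polynomial_fun n (\<lambda>x. \<Sum>e\<in>E. \<Sum>e'\<in>F. c e * b e' * (\<Prod>i<n. (x $ i) ^ (e i + e' i)))"
    by (intro polynomial_fun_sum polynomial_fun_monomial)
  moreover have "f x * g x =
      (\<Sum>e\<in>E. \<Sum>e'\<in>F. c e * b e' * (\<Prod>i<n. (x $ i) ^ (e i + e' i)))" if "x \<in> carrier_vec n" for x
    unfolding E(2)[OF that] F(2)[OF that] sum_product power_add prod.distrib
    by (intro sum.cong refl) simp
  ultimately show ?thesis
    by (rule polynomial_fun_cong[rotated])
qed

lemma polynomial_fun_power: "polynomial_fun n f \<Longrightarrow> polynomial_fun n (\<lambda>x. f x ^ k)"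
  by (induction k) (auto intro: polynomial_fun_const polynomial_fun_mult)

lemma polynomial_fun_coord:
  assumes "j < n"
  shows "polynomial_fun n (\<lambda>x. x $ j)"
proof -
  have "(\<Prod>i<n. (x $ i) ^ (if i = j then 1 else 0)) = x $ j" for x :: "complex Matrix.vec"
  proof -
    have "(\<Prod>i<n. (x $ i) ^ (if i = j then 1 else 0)) = (\<Prod>i<n. if i = j then x $ i else 1)"
      by (intro prod.cong) auto
    then show ?thesis
      using assms by simp
  qed
  then show ?thesis
    using polynomial_fun_monomial[of n 1 "\<lambda>i. if i = j then 1 else 0"] by simp
qed

section \<open>General facts on Newton's iterations\<close>

lemma newton_iter_carrier [simp]:
  "A \<in> carrier_mat n n \<Longrightarrow> y \<in> carrier_vec n \<Longrightarrow> newton_iter A \<phi> t y \<in> carrier_vec n"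
  by (induction t) auto

lemma newton_map_carrier [simp]:
  "A \<in> carrier_mat n n \<Longrightarrow> y \<in> carrier_vec n \<Longrightarrow> newton_map A \<phi> y \<in> carrier_vec n"
  by (auto simp: newton_map_def)

lemma mult_mat_vec_index_sum:
  assumes "A \<in> carrier_mat n n" "v \<in> carrier_vec n" "r < n"
  shows "(A *\<^sub>v v) $ r = (\<Sum>c<n. A $$ (r, c) * v $ c)"
  using assms by (auto simp: scalar_prod_def atLeast0LessThan intro!: sum.cong)

lemma polynomial_map_newton_iter:
  assumes A: "A \<in> carrier_mat n n"
  shows "polynomial_map n (newton_iter A (\<lambda>z. z ^ d) t)"
proof -
  have "\<forall>r<n. polynomial_fun n (\<lambda>y. newton_iter A (\<lambda>z. z ^ d) t y $ r)"
  proof (induction t)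
    case 0
    then show ?case by (simp add: polynomial_fun_coord)
  next
    case (Suc t)
    show ?case
    proof (intro allI impI)
      fix r assume r: "r < n"
      have "polynomial_fun n (\<lambda>y. y $ r +
          (- 1) * (\<Sum>c<n. A $$ (r, c) * newton_iter A (\<lambda>z. z ^ d) t y $ c) ^ d)"
        using Suc r by (intro polynomial_fun_add polynomial_fun_coord polynomial_fun_mult
            polynomial_fun_const polynomial_fun_power polynomial_fun_sum) auto
      then show "polynomial_fun n (\<lambda>y. newton_iter A (\<lambda>z. z ^ d) (Suc t) y $ r)"
      proof (rule polynomial_fun_cong[rotated])
        fix x :: "complex Matrix.vec" assume x: "x \<in> carrier_vec n"
        then have N: "newton_iter A (\<lambda>z. z ^ d) t x \<in> carrier_vec n" using A by simp
        show "newton_iter A (\<lambda>z. z ^ d) (Suc t) x $ r = x $ r +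
          (- 1) * (\<Sum>c<n. A $$ (r, c) * newton_iter A (\<lambda>z. z ^ d) t x $ c) ^ d"
          using mult_mat_vec_index_sum[OF A N r] A r x by simp
      qed
    qed
  qed
  then show ?thesis
    using A by (auto simp: polynomial_map_def)
qed

text \<open>Along a coordinate line through \<open>x\<close> the vector \<open>A x\<close> moves
  affinely, with slope the corresponding column of \<open>A\<close>, so each partial derivative is
  that of an explicit polynomial in \<open>t\<close>.\<close>

lemma jacobian_newton_map:
  assumes A: "A \<in> carrier_mat n n" and x: "x \<in> carrier_vec n"
  shows "jacobian_matrix n (newton_map A (\<lambda>z. z ^ d)) x =
    1\<^sub>m n + Matrix.mat n n (\<lambda>(r, c). of_nat d * ((A *\<^sub>v x) $ r) ^ (d - 1) * A $$ (r, c))"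
proof (rule eq_matI)
  fix r c
  assume "r < dim_row (1\<^sub>m n + Matrix.mat n n (\<lambda>(r, c). of_nat d * ((A *\<^sub>v x) $ r) ^ (d - 1) * A $$ (r, c)))"
    and "c < dim_col (1\<^sub>m n + Matrix.mat n n (\<lambda>(r, c). of_nat d * ((A *\<^sub>v x) $ r) ^ (d - 1) * A $$ (r, c)))"
  then have r: "r < n" and c: "c < n" by auto
  have "newton_map A (\<lambda>z. z ^ d) (x + t \<cdot>\<^sub>v unit_vec n c) $ r =
      x $ r + t * (if r = c then 1 else 0) + ((A *\<^sub>v x) $ r + t * A $$ (r, c)) ^ d" for t
  proof -
    have "(A *\<^sub>v (x + t \<cdot>\<^sub>v unit_vec n c)) $ r = (\<Sum>k<n. A $$ (r, k) * x $ k + A $$ (r, k) * (t * (if k = c then 1 else 0)))"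
      using A x r c by (subst mult_mat_vec_index_sum[OF A]) (auto intro!: sum.cong simp: algebra_simps)
    also have "\<dots> = (A *\<^sub>v x) $ r + (\<Sum>k<n. if k = c then A $$ (r, k) * t else 0)"
      unfolding sum.distrib mult_mat_vec_index_sum[OF A x r]
      by (intro arg_cong2[where f = "(+)"] sum.cong) auto
    also have "\<dots> = (A *\<^sub>v x) $ r + t * A $$ (r, c)"
      using c by simp
    finally show ?thesis
      using A x r c by (simp add: newton_map_def)
  qed
  moreover have "((\<lambda>t. x $ r + t * (if r = c then 1 else 0) + ((A *\<^sub>v x) $ r + t * A $$ (r, c)) ^ d)
      has_field_derivative (if r = c then 1 else 0) + of_nat d * ((A *\<^sub>v x) $ r) ^ (d - 1) * A $$ (r, c)) (at 0)"
    by (auto intro!: derivative_eq_intros)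
  ultimately show "jacobian_matrix n (newton_map A (\<lambda>z. z ^ d)) x $$ (r, c) =
    (1\<^sub>m n + Matrix.mat n n (\<lambda>(r, c). of_nat d * ((A *\<^sub>v x) $ r) ^ (d - 1) * A $$ (r, c))) $$ (r, c)"
    using r c by (simp add: jacobian_matrix_def DERIV_imp_deriv)
qed (auto simp: jacobian_matrix_def)

section \<open>Stationarity and the Newton order\<close>

lemma newton_stable_mono: "newton_stable A \<phi> k \<Longrightarrow> k \<le> l \<Longrightarrow> newton_stable A \<phi> l"
  unfolding newton_stable_def by (metis le_trans)

lemma newton_order_eq_Least:
  assumes "newton_stable A \<phi> k"
  shows "newton_order A \<phi> = enat (LEAST k. newton_stable A \<phi> k)"
  using assms by (auto simp: newton_order_def)

lemma newton_order_le:
  "newton_stable A \<phi> k \<Longrightarrow> newton_order A \<phi> \<le> enat k"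
  by (simp add: newton_order_eq_Least Least_le)

text \<open>Stable indices form an upward closed set, so the least one is found by testing a single
  predecessor.\<close>

lemma newton_order_eq_Suc_iff:
  assumes "newton_stable A \<phi> (Suc k)"
  shows "newton_order A \<phi> = enat (Suc k) \<longleftrightarrow> \<not> newton_stable A \<phi> k"
proof
  assume "newton_order A \<phi> = enat (Suc k)"
  then show "\<not> newton_stable A \<phi> k"
    using newton_order_le[of A \<phi> k] by auto
next
  assume k: "\<not> newton_stable A \<phi> k"
  have "(LEAST k. newton_stable A \<phi> k) = Suc k"
  proof (rule Least_equality)
    show "newton_stable A \<phi> (Suc k)" by (rule assms)
    show "Suc k \<le> l" if "newton_stable A \<phi> l" for l
      using k newton_stable_mono[OF that, of k] by (cases "l \<le> k") auto
  qed
  then show "newton_order A \<phi> = enat (Suc k)"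
    by (simp add: newton_order_eq_Least[OF assms])
qed

text \<open>Reduces the maximality of the order to comparing two consecutive iterates.\<close>

lemma newton_stable_Suc_iff:
  assumes "newton_stable A \<phi> (Suc k)"
  shows "newton_stable A \<phi> k \<longleftrightarrow>
    (\<forall>y\<in>carrier_vec (dim_row A). newton_iter A \<phi> (Suc k) y = newton_iter A \<phi> k y)"
proof
  assume "newton_stable A \<phi> k"
  then show "\<forall>y\<in>carrier_vec (dim_row A). newton_iter A \<phi> (Suc k) y = newton_iter A \<phi> k y"
    unfolding newton_stable_def using le_SucI by blast
next
  assume eq: "\<forall>y\<in>carrier_vec (dim_row A). newton_iter A \<phi> (Suc k) y = newton_iter A \<phi> k y"
  show "newton_stable A \<phi> k"
    unfolding newton_stable_def
  proof (intro allI impI ballI)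
    fix j and y :: "complex Matrix.vec" assume "k \<le> j" and y: "y \<in> carrier_vec (dim_row A)"
    show "newton_iter A \<phi> j y = newton_iter A \<phi> k y"
    proof (cases "j = k")
      case False
      with \<open>k \<le> j\<close> have "Suc k \<le> j" by simp
      then have "newton_iter A \<phi> j y = newton_iter A \<phi> (Suc k) y"
        using assms y unfolding newton_stable_def by blast
      then show ?thesis using eq y by simp
    qed simp
  qed
qed

text \<open>Allows any known stable index in place of the least one, which depends on the
  parameters.\<close>

lemma newton_fin_eq:
  assumes "newton_stable A \<phi> k" "y \<in> carrier_vec (dim_row A)"
  shows "newton_fin A \<phi> y = newton_iter A \<phi> k y"
proof -
  have "newton_stable A \<phi> (LEAST k. newton_stable A \<phi> k)" "(LEAST k. newton_stable A \<phi> k) \<le> k"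
    using assms(1) by (auto intro: LeastI Least_le)
  then show ?thesis
    using assms(2) unfolding newton_fin_def newton_stable_def by (blast intro: sym)
qed

section \<open>Matrices that are triangular on linear forms\<close>

text \<open>Abstracts from the block matrices: rows of one level share a linear form up to the
  factor \<open>h r\<close>. Only the action on these forms is triangular, by
  \<open>coupling_zero\<close>; \<open>A\<close> itself need not be triangular in any order of the
  coordinates.\<close>

locale levelled_matrix =
  fixes A :: "complex Matrix.mat" and n m d :: nat
    and lev :: "nat \<Rightarrow> nat" and h :: "nat \<Rightarrow> complex" and g :: "nat \<Rightarrow> nat \<Rightarrow> complex"
  assumes A_carrier [simp]: "A \<in> carrier_mat n n"
    and entry: "r < n \<Longrightarrow> c < n \<Longrightarrow> A $$ (r, c) = h r * g (lev r) c"
    and lev_less: "r < n \<Longrightarrow> lev r < m"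
    and d_ge_2: "2 \<le> d"
    and coupling_zero: "i < m \<Longrightarrow> k < m \<Longrightarrow> i \<le> k \<Longrightarrow>
      (\<Sum>c | c < n \<and> lev c = k. g i c * h c ^ d) = 0"
begin

text \<open>The coefficients W of the opening text, with the blocks numbered by level.\<close>

definition coupling :: "nat \<Rightarrow> nat \<Rightarrow> complex" where
  "coupling i k = (\<Sum>c | c < n \<and> lev c = k. g i c * h c ^ d)"

definition form :: "nat \<Rightarrow> complex Matrix.vec \<Rightarrow> complex" where
  "form i v = (\<Sum>c<n. g i c * v $ c)"

abbreviation N :: "nat \<Rightarrow> complex Matrix.vec \<Rightarrow> complex Matrix.vec" where
  "N \<equiv> newton_iter A (\<lambda>z. z ^ d)"

abbreviation F :: "complex Matrix.vec \<Rightarrow> complex Matrix.vec" where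
  "F \<equiv> newton_map A (\<lambda>z. z ^ d)"

lemma A_dim [simp]: "dim_row A = n" "dim_col A = n"
  using A_carrier by (auto simp del: A_carrier)

lemma mult_index:
  assumes "v \<in> carrier_vec n" "r < n"
  shows "(A *\<^sub>v v) $ r = h r * form (lev r) v"
  unfolding mult_mat_vec_index_sum[OF A_carrier assms] form_def sum_distrib_left
  using assms(2) by (intro sum.cong refl) (simp add: entry)

lemma form_add: "v \<in> carrier_vec n \<Longrightarrow> w \<in> carrier_vec n \<Longrightarrow> form i (v + w) = form i v + form i w"
  by (simp add: form_def sum.distrib distrib_left)

lemma form_diff: "v \<in> carrier_vec n \<Longrightarrow> w \<in> carrier_vec n \<Longrightarrow> form i (v - w) = form i v - form i w"
  by (simp add: form_def sum_subtractf right_diff_distrib)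

lemma form_smult: "v \<in> carrier_vec n \<Longrightarrow> form i (t \<cdot>\<^sub>v v) = t * form i v"
  by (simp add: form_def sum_distrib_left mult_ac)

text \<open>Grouping the columns by level takes \<open>f\<close> out of each group and leaves a
  coupling coefficient. The function \<open>f\<close> is arbitrary because both the d-th powers in
  the map and its derivative have this shape.\<close>

lemma form_levelled:
  assumes "i < m"
  shows "form i (Matrix.vec n (\<lambda>c. h c ^ d * f (lev c))) = (\<Sum>k<i. coupling i k * f k)"
proof -
  have "form i (Matrix.vec n (\<lambda>c. h c ^ d * f (lev c))) = (\<Sum>c<n. g i c * h c ^ d * f (lev c))"
    by (simp add: form_def mult_ac)
  also have "\<dots> = (\<Sum>k<m. \<Sum>c | c \<in> {..<n} \<and> lev c = k. g i c * h c ^ d * f (lev c))"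
    by (rule sum.group[symmetric]) (auto simp: lev_less)
  also have "\<dots> = (\<Sum>k<m. coupling i k * f k)"
    unfolding coupling_def sum_distrib_right by (intro sum.cong) auto
  also have "\<dots> = (\<Sum>k<i. coupling i k * f k)"
    using assms by (intro sum.mono_neutral_right) (auto simp: coupling_def coupling_zero)
  finally show ?thesis .
qed

lemma map_power_mult:
  assumes "v \<in> carrier_vec n"
  shows "map_vec (\<lambda>z. z ^ d) (A *\<^sub>v v) = Matrix.vec n (\<lambda>c. h c ^ d * form (lev c) v ^ d)"
proof (rule eq_vecI)
  fix r
  assume "r < dim_vec (Matrix.vec n (\<lambda>c. h c ^ d * form (lev c) v ^ d))"
  then have r: "r < n" by simp
  then have "map_vec (\<lambda>z. z ^ d) (A *\<^sub>v v) $ r = ((A *\<^sub>v v) $ r) ^ d"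
    by simp
  then show "map_vec (\<lambda>z. z ^ d) (A *\<^sub>v v) $ r = Matrix.vec n (\<lambda>c. h c ^ d * form (lev c) v ^ d) $ r"
    using mult_index[OF assms r] r by (simp add: power_mult_distrib)
qed simp

lemma N_carrier [simp]: "y \<in> carrier_vec n \<Longrightarrow> N t y \<in> carrier_vec n"
  by (simp add: newton_iter_carrier[where n = n])

lemma F_carrier [simp]: "y \<in> carrier_vec n \<Longrightarrow> F y \<in> carrier_vec n"
  by (simp add: newton_map_carrier[where n = n])

lemma form_map_power_mult:
  "v \<in> carrier_vec n \<Longrightarrow> i < m \<Longrightarrow>
    form i (map_vec (\<lambda>z. z ^ d) (A *\<^sub>v v)) = (\<Sum>k<i. coupling i k * form k v ^ d)"
  by (simp only: map_power_mult form_levelled[where f = "\<lambda>k. form k v ^ d"])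

lemma map_power_mult_carrier:
  "map_vec (\<lambda>z. z ^ d) (A *\<^sub>v v) \<in> carrier_vec n"
  by (rule carrier_vecI) simp

lemma form_N_Suc:
  "y \<in> carrier_vec n \<Longrightarrow> i < m \<Longrightarrow>
    form i (N (Suc t) y) = form i y - (\<Sum>k<i. coupling i k * form k (N t y) ^ d)"
  by (simp only: newton_iter.simps form_diff[OF _ map_power_mult_carrier] form_map_power_mult N_carrier)

lemma form_F:
  "x \<in> carrier_vec n \<Longrightarrow> i < m \<Longrightarrow>
    form i (F x) = form i x + (\<Sum>k<i. coupling i k * form k x ^ d)"
  by (simp only: newton_map_def form_add[OF _ map_power_mult_carrier] form_map_power_mult)

section \<open>Stationarity of the iterates and inversion of the map\<close>

lemma N_Suc_index:
  assumes "y \<in> carrier_vec n" "r < n"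
  shows "N (Suc t) y $ r = y $ r - h r ^ d * form (lev r) (N t y) ^ d"
  using assms by (simp add: map_power_mult)

lemma F_index:
  assumes "x \<in> carrier_vec n" "r < n"
  shows "F x $ r = x $ r + h r ^ d * form (lev r) x ^ d"
  using assms by (simp add: newton_map_def map_power_mult)

text \<open>Form \<open>i\<close> at step \<open>t + 1\<close> depends only on \<open>y\<close> and
  on the forms below \<open>i\<close> at step \<open>t\<close>. So form 0 never moves, and every
  step settles one more form.\<close>

lemma form_N_stable:
  assumes y: "y \<in> carrier_vec n"
  shows "i < m \<Longrightarrow> i \<le> t \<Longrightarrow> form i (N (Suc t) y) = form i (N t y)"
proof (induction t arbitrary: i)
  case 0
  then show ?case using form_N_Suc[OF y, of 0 0] by simp
next
  case (Suc t)
  then show ?case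
    unfolding form_N_Suc[OF y \<open>i < m\<close>] by (intro arg_cong2[where f = "(-)"] refl sum.cong) auto
qed

text \<open>The same triangular induction: once the lower forms agree with those of
  \<open>x\<close>, the sums in \<open>form_N_Suc\<close> and \<open>form_F\<close> cancel.\<close>

lemma form_N_F:
  assumes x: "x \<in> carrier_vec n"
  shows "i < m \<Longrightarrow> i \<le> t \<Longrightarrow> form i (N t (F x)) = form i x"
proof (induction t arbitrary: i)
  case 0
  then show ?case using form_F[OF x, of 0] by simp
next
  case (Suc t)
  then have "(\<Sum>k<i. coupling i k * form k (N t (F x)) ^ d) = (\<Sum>k<i. coupling i k * form k x ^ d)"
    by (intro sum.cong) auto
  with Suc.prems(1) show ?case
    using form_N_Suc[of "F x" i t] form_F[OF x, of i] x by simp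
qed

lemma N_stable:
  assumes "m \<le> t" "y \<in> carrier_vec n"
  shows "N (Suc t) y = N t y"
proof (rule eq_vecI)
  fix r assume "r < dim_vec (N t y)"
  then have r: "r < n" using N_carrier[OF assms(2), of t] by simp
  \<comment> \<open>Entries lag one step behind the forms: levels are at most \<open>m - 1\<close>
    and settled at \<open>t' = t - 1\<close>, the entries themselves only at
    \<open>t\<close>.\<close>
  then obtain t' where t': "t = Suc t'" "lev r \<le> t'"
    using lev_less[OF r] assms(1) by (cases t) auto
  show "N (Suc t) y $ r = N t y $ r"
    unfolding t'(1) N_Suc_index[OF assms(2) r]
    using form_N_stable[OF assms(2) lev_less[OF r] t'(2)] by simp
next
  show "dim_vec (N (Suc t) y) = dim_vec (N t y)"
    using N_carrier[OF assms(2), of t] N_carrier[OF assms(2), of "Suc t"]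
    by (simp only: carrier_vecD)
qed

lemma newton_stable_m: "newton_stable A (\<lambda>z. z ^ d) m"
  unfolding newton_stable_def
proof (intro allI impI ballI)
  fix j and y :: "complex Matrix.vec"
  assume "m \<le> j" and y: "y \<in> carrier_vec (dim_row A)"
  then show "N j y = N m y"
  proof (induction j rule: dec_induct)
    case (step j)
    then show ?case using N_stable[of j y] by (simp del: newton_iter.simps)
  qed simp
qed

text \<open>A stationary iterate equals \<open>y\<close> minus the d-th power of its own image under
  \<open>A\<close>, which is the equation to be solved.\<close>

lemma F_N:
  assumes "y \<in> carrier_vec n"
  shows "F (N m y) = y"
proof (rule eq_vecI)
  fix r assume "r < dim_vec y"
  then have r: "r < n" using assms by simp
  have "F (N m y) $ r = N m y $ r + h r ^ d * form (lev r) (N m y) ^ d"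
    using assms r by (simp add: F_index)
  also have "\<dots> = N (Suc m) y $ r + h r ^ d * form (lev r) (N m y) ^ d"
    using N_stable[OF order_refl assms] by simp
  finally show "F (N m y) $ r = y $ r"
    using assms r by (simp add: N_Suc_index del: newton_iter.simps)
next
  have "F (N m y) \<in> carrier_vec n"
    using assms by simp
  then show "dim_vec (F (N m y)) = dim_vec y"
    using assms by (simp only: carrier_vecD)
qed

lemma N_F:
  assumes "x \<in> carrier_vec n"
  shows "N m (F x) = x"
proof -
  \<comment> \<open>\<open>form_N_F\<close> controls only the forms. One more iteration, which sees
    the previous iterate through its forms alone, recovers the entries.\<close>
  have "N (Suc m) (F x) = x"
  proof (rule eq_vecI)
    fix r assume "r < dim_vec x"
    then have r: "r < n" using assms by simp
    have "form (lev r) (N m (F x)) = form (lev r) x"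
      using lev_less[OF r] by (intro form_N_F[OF assms]) auto
    then show "N (Suc m) (F x) $ r = x $ r"
      using assms r by (simp add: N_Suc_index F_index del: newton_iter.simps)
  next
    have "N (Suc m) (F x) \<in> carrier_vec n"
      using assms by (simp del: newton_iter.simps)
    then show "dim_vec (N (Suc m) (F x)) = dim_vec x"
      using assms by (simp only: carrier_vecD)
  qed
  then show ?thesis
    using N_stable[of m "F x"] assms by (simp del: newton_iter.simps)
qed

section \<open>Polynomial inverse and unit Jacobian\<close>

lemma inverse_maps_N: "inverse_maps n F (N m)"
  using F_N N_F by (auto simp: inverse_maps_def)

lemma inverse_maps_newton_fin: "inverse_maps n F (newton_fin A (\<lambda>z. z ^ d))"
proof -
  have "newton_fin A (\<lambda>z. z ^ d) y = N m y" if "y \<in> carrier_vec n" for y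
    using newton_fin_eq[OF newton_stable_m, of y] that by simp
  then show ?thesis
    using F_N N_F by (auto simp: inverse_maps_def)
qed

lemma polynomially_invertible: "polynomially_invertible n F"
  unfolding polynomially_invertible_def
  using inverse_maps_N polynomial_map_newton_iter[OF A_carrier] by blast

text \<open>The derivative of \<open>F - id\<close> acts on the forms through the coupling coefficients alone,
  hence by a strictly triangular matrix. So its only eigenvalue is zero.\<close>

lemma unit_jacobian: "unit_jacobian n F"
  unfolding unit_jacobian_def
proof
  fix x :: "complex Matrix.vec" assume x: "x \<in> carrier_vec n"
  define M where "M = Matrix.mat n n (\<lambda>(r, c). of_nat d * ((A *\<^sub>v x) $ r) ^ (d - 1) * A $$ (r, c))"
  have M: "M \<in> carrier_mat n n" by (simp add: M_def)
  \<comment> \<open>The factor \<open>h r ^ (d - 1)\<close> from the derivative and the factor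
    \<open>h r\<close> from the row combine to \<open>h r ^ d\<close>, as
    \<open>form_levelled\<close> requires.\<close>
  have Mv: "M *\<^sub>v v =
      Matrix.vec n (\<lambda>r. h r ^ d * (of_nat d * form (lev r) x ^ (d - 1) * form (lev r) v))"
    if v: "v \<in> carrier_vec n" for v
  proof (rule eq_vecI)
    fix r
    assume "r < dim_vec (Matrix.vec n (\<lambda>r. h r ^ d * (of_nat d * form (lev r) x ^ (d - 1) * form (lev r) v)))"
    then have r: "r < n" by simp
    have "(M *\<^sub>v v) $ r = (\<Sum>c<n. of_nat d * ((A *\<^sub>v x) $ r) ^ (d - 1) * (A $$ (r, c) * v $ c))"
      unfolding mult_mat_vec_index_sum[OF M v r] using r by (simp add: M_def mult_ac)
    also have "\<dots> = of_nat d * ((A *\<^sub>v x) $ r) ^ (d - 1) * (A *\<^sub>v v) $ r"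
      unfolding mult_mat_vec_index_sum[OF A_carrier v r] by (simp add: sum_distrib_left)
    also have "\<dots> = h r ^ (d - 1) * h r * (of_nat d * form (lev r) x ^ (d - 1) * form (lev r) v)"
      by (simp add: mult_index[OF x r] mult_index[OF v r] power_mult_distrib)
    also have "h r ^ (d - 1) * h r = h r ^ d"
      using d_ge_2 by (simp add: power_eq_if)
    finally show "(M *\<^sub>v v) $ r =
      Matrix.vec n (\<lambda>r. h r ^ d * (of_nat d * form (lev r) x ^ (d - 1) * form (lev r) v)) $ r"
      using r by simp
  qed (simp add: M_def)
  have "\<mu> = 0" if v: "v \<in> carrier_vec n" and ev: "M *\<^sub>v v = \<mu> \<cdot>\<^sub>v v" and v0: "v \<noteq> 0\<^sub>v n" for v \<mu>
  proof (rule ccontr)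
    assume \<mu>: "\<mu> \<noteq> 0"
    \<comment> \<open>For a nonzero eigenvalue the forms of an eigenvector vanish level by level.
      Then \<open>M\<close> annihilates the vector, so it is zero.\<close>
    have "form i v = 0" if "i < m" for i
      using that
    proof (induction i rule: less_induct)
      case (less i)
      have "\<mu> * form i v = form i (M *\<^sub>v v)"
        using v by (simp add: ev form_smult)
      also have "\<dots> = (\<Sum>k<i. coupling i k * (of_nat d * form k x ^ (d - 1) * form k v))"
        unfolding Mv[OF v]
        by (rule form_levelled[OF less.prems, of "\<lambda>k. of_nat d * form k x ^ (d - 1) * form k v"])
      also have "\<dots> = 0"
        using less by (intro sum.neutral) auto
      finally show ?case using \<mu> by simp
    qed
    then have "M *\<^sub>v v = 0\<^sub>v n"
      unfolding Mv[OF v] by (intro eq_vecI) (auto simp: lev_less)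
    then have "v = 0\<^sub>v n"
      using \<mu> v unfolding ev by (intro eq_vecI) (auto simp: vec_eq_iff)
    with v0 show False by simp
  qed
  then show "Determinant.det (jacobian_matrix n F x) = 1"
    unfolding jacobian_newton_map[OF A_carrier x] M_def[symmetric]
    by (intro det_one_plus_of_eigenvalues_zero[OF M]) auto
qed

section \<open>Criterion for the maximal order\<close>

text \<open>Up to a factor, \<open>gap (m - 1)\<close> is the last increment of Newton's iterates. For \<open>i = 0\<close> the iterate
  of index \<open>-1\<close> counts as \<open>0\<close>.\<close>

definition gap :: "nat \<Rightarrow> complex Matrix.vec \<Rightarrow> complex" where
  "gap i y = form i (N i y) ^ d - (if i = 0 then 0 else form i (N (i - 1) y) ^ d)"

lemma gap_0 [simp]: "gap 0 y = form 0 y ^ d"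
  by (simp add: gap_def)

lemma gap_Suc: "gap (Suc i) y = form (Suc i) (N (Suc i) y) ^ d - form (Suc i) (N i y) ^ d"
  by (simp add: gap_def del: newton_iter.simps)

text \<open>All forms below \<open>i\<close> were settled one step earlier, so only the term
  \<open>k = i\<close> of the sum changes, by a difference of d-th powers. For \<open>i = 0\<close>
  the whole sum is new, which is why \<open>gap\<close> then subtracts 0.\<close>

lemma form_N_increment:
  assumes y: "y \<in> carrier_vec n" and i: "Suc i < m"
  shows "form (Suc i) (N (Suc i) y) - form (Suc i) (N i y) = - coupling (Suc i) i * gap i y"
proof (cases i)
  case 0
  then show ?thesis using form_N_Suc[OF y i, of i] by (simp del: newton_iter.simps(2))
next
  case (Suc j)
  have "form k (N i y) = form k (N j y)" if "k < i" for k
    using form_N_stable[OF y, of k j] that i Suc by simp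
  then have "(\<Sum>k<i. coupling (Suc i) k * form k (N i y) ^ d) =
      (\<Sum>k<i. coupling (Suc i) k * form k (N j y) ^ d)"
    by (intro sum.cong) auto
  moreover have "form (Suc i) (N i y) =
      form (Suc i) y - (\<Sum>k<Suc i. coupling (Suc i) k * form k (N j y) ^ d)"
    unfolding Suc by (rule form_N_Suc[OF y]) (use i Suc in auto)
  moreover have gap: "gap i y = form i (N i y) ^ d - form i (N j y) ^ d"
    unfolding Suc by (rule gap_Suc)
  ultimately show ?thesis
    unfolding form_N_Suc[OF y i] gap by (simp add: algebra_simps del: newton_iter.simps)
qed

text \<open>Equal values have equal d-th powers: an increment lost at one level is lost at the
  next.\<close>

lemma gap_Suc_zero:
  assumes "y \<in> carrier_vec n" "Suc i < m" "coupling (Suc i) i * gap i y = 0"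
  shows "gap (Suc i) y = 0"
  using form_N_increment[OF assms(1,2)] assms(3) by (simp add: gap_Suc del: newton_iter.simps)

text \<open>Forms below the top level are already settled one step before, so entries of those
  levels no longer move.\<close>

lemma N_last_step:
  assumes y: "y \<in> carrier_vec n" and r: "r < n" and m: "m = Suc m'"
  shows "N m y $ r - N m' y $ r = (if lev r = m' then - (h r ^ d) * gap m' y else 0)"
proof (cases m')
  case 0
  then show ?thesis
    using lev_less[OF r] m y r by (simp add: N_Suc_index del: newton_iter.simps(2))
next
  case (Suc j)
  have diff: "N m y $ r - N (Suc j) y $ r = - (h r ^ d) * (form (lev r) (N (Suc j) y) ^ d - form (lev r) (N j y) ^ d)"
    unfolding m Suc N_Suc_index[OF y r] by (simp add: algebra_simps del: newton_iter.simps)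
  show ?thesis
  proof (cases "lev r = m'")
    case True
    then show ?thesis unfolding diff Suc by (simp add: gap_Suc del: newton_iter.simps)
  next
    case False
    then have "lev r \<le> j" using lev_less[OF r] m Suc by simp
    then show ?thesis
      unfolding diff Suc using form_N_stable[OF y lev_less[OF r]] False Suc by (simp del: newton_iter.simps)
  qed
qed

text \<open>A vector of powers of one number \<open>t\<close>: each form becomes a nonzero polynomial in \<open>t\<close>.\<close>

lemma exists_forms_nonzero:
  assumes "\<And>i. i < m \<Longrightarrow> \<exists>c<n. g i c \<noteq> 0"
  shows "\<exists>v\<in>carrier_vec n. \<forall>i<m. form i v \<noteq> 0"
proof -
  have "finite {t. (\<Sum>c<n. g i c * t ^ c) = 0}" if "i < m" for i
  proof -
    obtain c where c: "c < n" "g i c \<noteq> 0"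
      using assms[OF \<open>i < m\<close>] by blast
    define q where "q = (\<Sum>c<n. Polynomial.monom (g i c) c)"
    have "coeff q c = g i c"
      using c by (simp add: q_def coeff_sum)
    then have "q \<noteq> 0" using c by auto
    then have "finite {t. poly q t = 0}"
      by (rule poly_roots_finite)
    then show ?thesis
      by (simp add: q_def poly_sum poly_monom)
  qed
  then have "finite (\<Union>i<m. {t. (\<Sum>c<n. g i c * t ^ c) = 0})"
    by blast
  then obtain t where "t \<notin> (\<Union>i<m. {t. (\<Sum>c<n. g i c * t ^ c) = 0})"
    using ex_new_if_finite[OF infinite_UNIV_char_0] by blast
  then have "form i (Matrix.vec n (\<lambda>c. t ^ c)) \<noteq> 0" if "i < m" for i
    using that by (auto simp: form_def)
  then show ?thesis
    by (intro bexI[of _ "Matrix.vec n (\<lambda>c. t ^ c)"]) auto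
qed

text \<open>Near \<open>0\<close> the iterates are dominated by their common linear part, which forbids that two
  different values have equal \<open>d\<close>-th powers.\<close>

lemma form_N_asymptotic:
  assumes v: "v \<in> carrier_vec n"
  shows "i < m \<Longrightarrow> ((\<lambda>\<tau>. form i (N t (\<tau> \<cdot>\<^sub>v v)) / \<tau>) \<longlongrightarrow> form i v) (at 0)"
proof (induction t arbitrary: i)
  case 0
  have "\<forall>\<^sub>F \<tau> in at 0. form i (N 0 (\<tau> \<cdot>\<^sub>v v)) / \<tau> = form i v"
    using v by (auto simp: eventually_at_filter form_smult)
  then show ?case
    by (rule tendsto_eventually)
next
  case (Suc t)
  let ?q = "\<lambda>k \<tau>. form k (N t (\<tau> \<cdot>\<^sub>v v)) / \<tau>"
  \<comment> \<open>Each correction is a d-th power; after division by \<tau> a factor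
    \<open>\<tau> ^ (d - 1)\<close> remains, which tends to 0 because \<open>d\<close> is at least
    2.\<close>
  have "form i (N (Suc t) (\<tau> \<cdot>\<^sub>v v)) / \<tau> = form i v - (\<Sum>k<i. coupling i k * (?q k \<tau> ^ d * \<tau> ^ (d - 1)))"
    if "\<tau> \<noteq> 0" for \<tau>
  proof -
    have "?q k \<tau> ^ d * \<tau> ^ (d - 1) = form k (N t (\<tau> \<cdot>\<^sub>v v)) ^ d / \<tau>" for k
      using d_ge_2 that by (cases d) (auto simp: power_divide)
    moreover have "form i (N (Suc t) (\<tau> \<cdot>\<^sub>v v)) =
        \<tau> * form i v - (\<Sum>k<i. coupling i k * form k (N t (\<tau> \<cdot>\<^sub>v v)) ^ d)"
      using v by (subst form_N_Suc[OF _ Suc.prems]) (simp_all add: form_smult)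
    ultimately show ?thesis
      using that by (simp add: diff_divide_distrib sum_divide_distrib del: newton_iter.simps)
  qed
  then have ev: "\<forall>\<^sub>F \<tau> in at 0. form i v - (\<Sum>k<i. coupling i k * (?q k \<tau> ^ d * \<tau> ^ (d - 1))) =
      form i (N (Suc t) (\<tau> \<cdot>\<^sub>v v)) / \<tau>"
    by (auto simp: eventually_at_filter simp del: newton_iter.simps)
  have "((\<lambda>\<tau>. form i v - (\<Sum>k<i. coupling i k * (?q k \<tau> ^ d * \<tau> ^ (d - 1)))) \<longlongrightarrow>
      form i v - (\<Sum>k<i. coupling i k * (form k v ^ d * 0 ^ (d - 1)))) (at 0)"
    using Suc.prems by (intro tendsto_intros Suc.IH) auto
  also have "(\<Sum>k<i. coupling i k * (form k v ^ d * 0 ^ (d - 1))) = 0"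
    using d_ge_2 by (simp add: power_0_left)
  finally show ?case
    using Lim_transform_eventually[OF _ ev] by simp
qed

text \<open>By \<open>form_N_increment\<close> a nonzero gap and a nonzero coupling give two
  different values of the next form. Different numbers can share a d-th power, but not if both are
  asymptotic to the same nonzero multiple of a small \<tau>.\<close>

lemma gap_eventually_nonzero:
  assumes v: "v \<in> carrier_vec n" and nz: "\<And>i. i < m \<Longrightarrow> form i v \<noteq> 0"
    and coup: "\<And>i. Suc i < m \<Longrightarrow> coupling (Suc i) i \<noteq> 0"
  shows "i < m \<Longrightarrow> \<forall>\<^sub>F \<tau> in at 0. gap i (\<tau> \<cdot>\<^sub>v v) \<noteq> 0"
proof (induction i)
  case 0
  have "\<forall>\<^sub>F \<tau> in at 0. (\<tau> :: complex) \<noteq> 0"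
    by (simp add: eventually_at_filter)
  then show ?case
    by eventually_elim (use 0 v nz in \<open>simp add: form_smult\<close>)
next
  case (Suc i)
  let ?x = "\<lambda>\<tau>. form (Suc i) (N (Suc i) (\<tau> \<cdot>\<^sub>v v))" and ?y = "\<lambda>\<tau>. form (Suc i) (N i (\<tau> \<cdot>\<^sub>v v))"
  \<comment> \<open>The cofactor of x - y in x^d - y^d for the rescaled values; its limit is d times
    a power of \<open>?l\<close>, hence nonzero.\<close>
  let ?S = "\<lambda>\<tau>. \<Sum>j<d. (?y \<tau> / \<tau>) ^ (d - Suc j) * (?x \<tau> / \<tau>) ^ j"
  let ?l = "form (Suc i) v"
  have "(?S \<longlongrightarrow> (\<Sum>j<d. ?l ^ (d - Suc j) * ?l ^ j)) (at 0)"
    by (intro tendsto_intros form_N_asymptotic v Suc.prems)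
  also have "(\<Sum>j<d. ?l ^ (d - Suc j) * ?l ^ j) = of_nat d * ?l ^ (d - 1)"
    by (simp add: power_add[symmetric])
  finally have "(?S \<longlongrightarrow> of_nat d * ?l ^ (d - 1)) (at 0)" .
  then have "\<forall>\<^sub>F \<tau> in at 0. ?S \<tau> \<noteq> 0"
    by (rule tendsto_imp_eventually_ne) (use nz[OF Suc.prems] d_ge_2 in auto)
  moreover have "\<forall>\<^sub>F \<tau> in at 0. gap i (\<tau> \<cdot>\<^sub>v v) \<noteq> 0"
    using Suc by simp
  moreover have "\<forall>\<^sub>F \<tau> in at 0. (\<tau> :: complex) \<noteq> 0"
    by (simp add: eventually_at_filter)
  ultimately show ?case
  proof eventually_elim
    case (elim \<tau>)
    have "?x \<tau> - ?y \<tau> \<noteq> 0"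
      using form_N_increment[of "\<tau> \<cdot>\<^sub>v v" i] elim coup Suc.prems v by (simp del: newton_iter.simps)
    then have ne: "?x \<tau> / \<tau> - ?y \<tau> / \<tau> \<noteq> 0"
      using elim by (simp del: newton_iter.simps)
    have "(?x \<tau> / \<tau>) ^ d - (?y \<tau> / \<tau>) ^ d \<noteq> 0"
      unfolding power_diff_sumr2 using ne elim(1) by (rule no_zero_divisors)
    then have "(?x \<tau> / \<tau>) ^ d \<noteq> (?y \<tau> / \<tau>) ^ d"
      by (simp only: right_minus_eq not_False_eq_True)
    then show ?case
      using elim(3) by (auto simp: gap_Suc power_divide simp del: newton_iter.simps)
  qed
qed

theorem newton_order_eq_iff:
  assumes "0 < m"
  shows "newton_order A (\<lambda>z. z ^ d) = enat m \<longleftrightarrow>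
    (\<exists>r<n. Suc (lev r) = m \<and> h r \<noteq> 0) \<and> (\<exists>c<n. g 0 c \<noteq> 0) \<and>
    (\<forall>i. Suc i < m \<longrightarrow> coupling (Suc i) i \<noteq> 0)"
    (is "_ \<longleftrightarrow> ?top \<and> ?bottom \<and> ?coup")
proof -
  obtain m' where m: "m = Suc m'"
    using assms by (cases m) auto
  \<comment> \<open>The iterates are stationary from \<open>m\<close> on, so the order is
    \<open>m\<close> iff the step from \<open>m - 1\<close> to \<open>m\<close> still changes
    something.\<close>
  have order: "newton_order A (\<lambda>z. z ^ d) = enat m \<longleftrightarrow> (\<exists>y\<in>carrier_vec n. N m y \<noteq> N m' y)"
    using newton_order_eq_Suc_iff[of A _ m'] newton_stable_Suc_iff[of A _ m'] newton_stable_m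
    unfolding m by simp
  have vanish: "gap m' y = 0" if "y \<in> carrier_vec n" "gap i y = 0 \<or> coupling (Suc i) i = 0 \<and> i < m'" "i < m" for i y
  proof -
    have base: "gap m' y = 0" if "gap j y = 0" "j \<le> m'" for j
      using that(2)
    proof (induction m' rule: dec_induct)
      case (step k)
      then show ?case using gap_Suc_zero[OF \<open>y \<in> carrier_vec n\<close>, of k] by (simp add: m)
    qed (rule that(1))
    show ?thesis
      using that base[of i] base[of "Suc i"] gap_Suc_zero[of y i] by (auto simp: m)
  qed
  show ?thesis
    unfolding order
  proof
    assume "\<exists>y\<in>carrier_vec n. N m y \<noteq> N m' y"
    then obtain y where y: "y \<in> carrier_vec n" "N m y \<noteq> N m' y" by blast
    have "\<exists>r<n. N m y $ r \<noteq> N m' y $ r"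
    proof (rule ccontr)
      assume "\<not> ?thesis"
      then have "N m y = N m' y"
        using carrier_vecD[OF N_carrier[OF y(1), of m]] carrier_vecD[OF N_carrier[OF y(1), of m']]
        by (intro eq_vecI) (auto simp del: newton_iter.simps)
      then show False using y by simp
    qed
    then obtain r where r: "r < n" "N m y $ r \<noteq> N m' y $ r" by blast
    then have "(if lev r = m' then - (h r ^ d) * gap m' y else 0) \<noteq> 0"
      using N_last_step[OF y(1) r(1) m] by (metis right_minus_eq)
    then have top: "lev r = m'" "h r \<noteq> 0" and gap: "gap m' y \<noteq> 0"
      using d_ge_2 by (auto split: if_splits simp: power_0_left)
    have "form 0 y \<noteq> 0"
      using gap vanish[OF y(1), of 0] d_ge_2 by (auto simp: m)
    then have "?bottom"
      unfolding form_def by (metis (no_types, lifting) lessThan_iff mult_zero_left sum.neutral)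
    moreover have "?coup"
      using gap vanish[OF y(1)] unfolding m by (metis Suc_less_eq less_SucI)
    ultimately show "?top \<and> ?bottom \<and> ?coup"
      using top r(1) m by blast
  next
    assume *: "?top \<and> ?bottom \<and> ?coup"
    \<comment> \<open>Above the bottom, a nonzero coupling already forces the form to be nonzero;
      only form 0 needs a condition of its own.\<close>
    have "\<exists>c<n. g i c \<noteq> 0" if "i < m" for i
    proof (cases i)
      case 0
      then show ?thesis using * by simp
    next
      case (Suc j)
      then have "coupling i j \<noteq> 0" using * that by blast
      then obtain c where "c < n" "g i c * h c ^ d \<noteq> 0"
        unfolding coupling_def by (metis (mono_tags, lifting) mem_Collect_eq sum.neutral)
      then show ?thesis by auto
    qed
    then obtain v where v: "v \<in> carrier_vec n" "\<forall>i<m. form i v \<noteq> 0"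
      using exists_forms_nonzero by blast
    have ev: "\<forall>\<^sub>F \<tau> in at 0. gap m' (\<tau> \<cdot>\<^sub>v v) \<noteq> 0"
      using v * by (intro gap_eventually_nonzero) (auto simp: m)
    then obtain \<tau> where \<tau>: "gap m' (\<tau> \<cdot>\<^sub>v v) \<noteq> 0"
      using eventually_happens'[OF at_neq_bot ev] by blast
    obtain r where r: "r < n" "lev r = m'" "h r \<noteq> 0"
      using * m by auto
    have "N m (\<tau> \<cdot>\<^sub>v v) $ r - N m' (\<tau> \<cdot>\<^sub>v v) $ r \<noteq> 0"
      using N_last_step[OF _ r(1) m, of "\<tau> \<cdot>\<^sub>v v"] r \<tau> v(1) by (simp del: newton_iter.simps)
    then have "N m (\<tau> \<cdot>\<^sub>v v) \<noteq> N m' (\<tau> \<cdot>\<^sub>v v)"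
      by (metis cancel_comm_monoid_add_class.diff_cancel)
    then show "\<exists>y\<in>carrier_vec n. N m y \<noteq> N m' y"
      using v(1) by (metis smult_carrier_vec)
  qed
qed

end

section \<open>The block matrices\<close>

lemma block_start_Suc: "j < length p \<Longrightarrow> block_start p (Suc j) = block_start p j + p ! j"
  by (simp add: block_start_def take_Suc_conv_app_nth)

lemma block_start_mono: "j \<le> k \<Longrightarrow> block_start p j \<le> block_start p k"
  unfolding block_start_def by (metis le_Suc_ex take_add sum_list_append le_add1)

lemma block_of_less_length:
  assumes "r < sum_list p"
  shows "block_of p r < length p"
proof -
  have "p \<noteq> []" using assms by auto
  then have "r < block_start p (Suc (length p - 1))"
    using assms by (simp add: block_start_def)
  then have "block_of p r \<le> length p - 1"
    unfolding block_of_def by (rule Least_le)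
  then show ?thesis using \<open>p \<noteq> []\<close> by (cases p) auto
qed

lemma block_of_bounds:
  assumes "r < sum_list p"
  shows "block_start p (block_of p r) \<le> r" "r < block_start p (block_of p r) + p ! block_of p r"
proof -
  have "p \<noteq> []" using assms by auto
  then have "r < block_start p (Suc (length p - 1))"
    using assms by (simp add: block_start_def)
  then have "r < block_start p (Suc (block_of p r))"
    unfolding block_of_def by (rule LeastI)
  then show "r < block_start p (block_of p r) + p ! block_of p r"
    using block_start_Suc[OF block_of_less_length[OF assms]] by simp
  show "block_start p (block_of p r) \<le> r"
  proof (cases "block_of p r")
    case 0
    then show ?thesis by (simp add: block_start_def)
  next
    case (Suc j)
    then have "\<not> r < block_start p (Suc j)"
      using not_less_Least[of j "\<lambda>j. r < block_start p (Suc j)"] unfolding block_of_def by simp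
    then show ?thesis using Suc by simp
  qed
qed

lemma block_of_eqI:
  assumes "k < length p" "block_start p k \<le> c" "c < block_start p k + p ! k"
  shows "block_of p c = k"
  unfolding block_of_def
proof (rule Least_equality)
  show "c < block_start p (Suc k)"
    using assms by (simp add: block_start_Suc)
  show "k \<le> j" if "c < block_start p (Suc j)" for j
    using that assms(2) block_start_mono[of "Suc j" k p] by (cases "k \<le> j") auto
qed

lemma block_end_le: "k < length p \<Longrightarrow> block_start p k + p ! k \<le> sum_list p"
  using block_start_mono[of "Suc k" "length p" p] by (simp add: block_start_Suc) (simp add: block_start_def)

lemma sum_block:
  assumes "k < length p"
  shows "(\<Sum>c | c < sum_list p \<and> block_of p c = k. f c) = (\<Sum>t<p ! k. f (block_start p k + t))"
proof (rule sum.reindex_bij_witness[of _ "\<lambda>t. block_start p k + t" "\<lambda>c. c - block_start p k"])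
  fix c assume "c \<in> {c. c < sum_list p \<and> block_of p c = k}"
  then have "c < sum_list p" "block_of p c = k" by auto
  then show "block_start p k + (c - block_start p k) = c" "c - block_start p k \<in> {..<p ! k}"
    "f (block_start p k + (c - block_start p k)) = f c"
    using block_of_bounds[of c p] by auto
next
  fix t assume t: "t \<in> {..<p ! k}"
  then show "block_start p k + t \<in> {c. c < sum_list p \<and> block_of p c = k}"
    using block_of_eqI[OF assms] block_end_le[OF assms] by auto
qed auto

text \<open>Conjugation by a permutation matrix relabels indices by the inverse permutation. Thus
  eta encodes a strict linear order of the blocks, with the inverse of \<pi> as rank.\<close>

lemma eta_mat_permutation:
  assumes \<pi>: "\<pi> permutes {..<m}" and j: "j < m" and k: "k < m"
  shows "eta_mat m (Matrix.mat m m (\<lambda>(j, k). if j = \<pi> k then 1 else 0)) $$ (j, k) =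
    (if inv_into UNIV \<pi> k < inv_into UNIV \<pi> j then 1 else 0)"
proof -
  let ?P = "Matrix.mat m m (\<lambda>(j, k). if j = \<pi> k then 1 else 0) :: int Matrix.mat"
  have inv: "inv_into UNIV \<pi> i < m" if "i < m" for i
    using permutes_in_image[OF permutes_inv[OF \<pi>], of i] that by simp
  have eq: "(i = \<pi> a) = (a = inv_into UNIV \<pi> i)" for i a
    using permutes_inverses[OF \<pi>] by metis
  have 1: "(?P * tau_mat m) $$ (j, b) = (if b < inv_into UNIV \<pi> j then 1 else 0)" if b: "b < m" for b
  proof -
    have "(?P * tau_mat m) $$ (j, b) = (\<Sum>a<m. (if j = \<pi> a then 1 else 0) * (if b < a then 1 else 0))"
      using j b by (auto simp: tau_mat_def scalar_prod_def atLeast0LessThan intro!: sum.cong)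
    also have "\<dots> = (\<Sum>a<m. if a = inv_into UNIV \<pi> j then if b < a then 1 else 0 else 0)"
      unfolding eq by (intro sum.cong) auto
    also have "\<dots> = (if b < inv_into UNIV \<pi> j then 1 else 0)"
      using inv[OF j] by simp
    finally show ?thesis .
  qed
  have "eta_mat m ?P $$ (j, k) = (\<Sum>b<m. (?P * tau_mat m) $$ (j, b) * (if k = \<pi> b then 1 else 0))"
    using j k unfolding eta_mat_def
    by (subst index_mult_mat(1))
      (auto simp: tau_mat_def scalar_prod_def atLeast0LessThan intro!: sum.cong)
  also have "\<dots> = (\<Sum>b<m. if b = inv_into UNIV \<pi> k then if b < inv_into UNIV \<pi> j then 1 else 0 else 0)"
  proof (rule sum.cong[OF refl])
    fix b assume "b \<in> {..<m}"
    then have "b < m" by simp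
    show "(?P * tau_mat m) $$ (j, b) * (if k = \<pi> b then 1 else 0) =
        (if b = inv_into UNIV \<pi> k then if b < inv_into UNIV \<pi> j then 1 else 0 else 0)"
      unfolding 1[OF \<open>b < m\<close>] unfolding eq by simp
  qed
  also have "\<dots> = (if inv_into UNIV \<pi> k < inv_into UNIV \<pi> j then 1 else 0)"
    using inv[OF k] by simp
  finally show ?thesis .
qed

text \<open>A row of block \<open>j\<close> of \<open>U\<close>: all rows of a block agree, so one-row blocks suffice.\<close>

definition U_row :: "nat list \<Rightarrow> int Matrix.mat \<Rightarrow> (nat \<Rightarrow> nat \<Rightarrow> nat \<Rightarrow> complex) \<Rightarrow> nat \<Rightarrow> nat \<Rightarrow> complex" where
  "U_row p P a j c = (let k = block_of p c in
     B_mat (eta_mat (length p) P $$ (j, k)) 1 (p ! k) (a j k) $$ (0, c - block_start p k))"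

text \<open>Neither \<open>i\<close> nor \<open>k\<close> occurs on the right, which is why one row
  per block carries everything. For \<open>e = 0\<close> and \<open>l = 1\<close> the empty sum
  yields the zero column.\<close>

lemma B_mat_index: "i < k \<Longrightarrow> j < l \<Longrightarrow> B_mat e k l a $$ (i, j) =
  (if e = 0 \<and> \<not> j < l - 1 then - (\<Sum>t<l - 1. a t) else a j)"
  by (simp add: B_mat_def Z_mat_def S_mat_def)

text \<open>The last column of a Z block cancels the other ones.\<close>

lemma B_mat_row_sum: "0 < l \<Longrightarrow> (\<Sum>t<l. B_mat e 1 l a $$ (0, t)) = (if e = 0 then 0 else \<Sum>t<l. a t)"
  by (cases l) (auto simp: B_mat_index)

lemma block_offset_less: "c < sum_list p \<Longrightarrow> c - block_start p (block_of p c) < p ! block_of p c"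
  using block_of_bounds[of c p] by linarith

lemma U_mat_index:
  assumes "r < sum_list p" "c < sum_list p"
  shows "U_mat p P a $$ (r, c) = U_row p P a (block_of p r) c"
  using assms block_offset_less[OF assms(1)] block_offset_less[OF assms(2)]
  by (simp add: U_mat_def U_row_def Let_def B_mat_index)

lemma U_row_block_sum:
  assumes k: "k < length p" and "0 < p ! k"
  shows "(\<Sum>c | c < sum_list p \<and> block_of p c = k. U_row p P a j c) =
    (if eta_mat (length p) P $$ (j, k) = 0 then 0 else \<Sum>t<p ! k. a j k t)"
proof -
  have "(\<Sum>c | c < sum_list p \<and> block_of p c = k. U_row p P a j c) =
      (\<Sum>t<p ! k. B_mat (eta_mat (length p) P $$ (j, k)) 1 (p ! k) (a j k) $$ (0, t))"
    unfolding sum_block[OF k] by (intro sum.cong) (auto simp: U_row_def block_of_eqI[OF k])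
  then show ?thesis
    using B_mat_row_sum[OF assms(2)] by simp
qed

text \<open>The parameter space carries the iterated product topology, so evaluation is a
  composition of three coordinate projections.\<close>

lemma continuous_on_evaluation: "continuous_on UNIV (\<lambda>a :: nat \<Rightarrow> nat \<Rightarrow> nat \<Rightarrow> complex. a j k t)"
  by (rule continuous_on_product_then_coordinatewise[where f = "\<lambda>a. a j k" and i = t],
      rule continuous_on_product_then_coordinatewise[where f = "\<lambda>a. a j" and i = k],
      rule continuous_on_product_coordinates)

lemma continuous_on_U_row:
  assumes "c < sum_list p"
  shows "continuous_on UNIV (\<lambda>a. U_row p P a j c)"
proof -
  let ?k = "block_of p c" and ?t = "c - block_start p (block_of p c)"
  have "U_row p P a j c = (if eta_mat (length p) P $$ (j, ?k) = 0 \<and> \<not> ?t < p ! ?k - 1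
      then - (\<Sum>t<p ! ?k - 1. a j ?k t) else a j ?k ?t)" for a
    using block_offset_less[OF assms] by (simp add: U_row_def Let_def B_mat_index)
  then show ?thesis
    \<comment> \<open>Which branch applies does not depend on \<open>a\<close>.\<close>
    by (cases "eta_mat (length p) P $$ (j, ?k) = 0 \<and> \<not> ?t < p ! ?k - 1")
      (auto intro!: continuous_on_minus continuous_on_sum continuous_on_evaluation)
qed

text \<open>The only root is -z/w; should it be 0, the punctured neighbourhood omits it.\<close>

lemma eventually_affine_nonzero:
  fixes z w :: complex
  assumes "w \<noteq> 0"
  shows "\<forall>\<^sub>F \<epsilon> in at 0. z + \<epsilon> * w \<noteq> 0"
proof -
  have "\<forall>\<^sub>F \<epsilon> in at 0. \<epsilon> \<noteq> - z / w"
    by (rule eventually_neq_at_within)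
  then show ?thesis
  proof eventually_elim
    case (elim \<epsilon>)
    show ?case
    proof
      assume "z + \<epsilon> * w = 0"
      then have "\<epsilon> * w = - z" by (simp add: add_eq_0_iff)
      with elim assms show False by (simp add: field_simps)
    qed
  qed
qed

section \<open>The block maps as levelled matrices\<close>

locale block_map =
  fixes p :: "nat list" and n d :: nat and P :: "int Matrix.mat" and \<pi> :: "nat \<Rightarrow> nat"
    and s :: "complex Matrix.vec"
  assumes n_eq: "sum_list p = n" and n_pos: "0 < n" and parts_pos: "\<And>q. q \<in> set p \<Longrightarrow> 0 < q"
    and \<pi>: "\<pi> permutes {..<length p}"
    and P_eq: "P = Matrix.mat (length p) (length p) (\<lambda>(j, k). if j = \<pi> k then 1 else 0)"
    and d: "2 \<le> d"
begin

abbreviation m :: nat where "m \<equiv> length p"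
abbreviation \<sigma> :: "nat \<Rightarrow> nat" where "\<sigma> \<equiv> inv_into UNIV \<pi>"
abbreviation lev :: "nat \<Rightarrow> nat" where "lev c \<equiv> \<sigma> (block_of p c)"
abbreviation h :: "nat \<Rightarrow> complex" where "h r \<equiv> \<Prod>i\<in>{..<n} - {r}. s $ i"
abbreviation A :: "(nat \<Rightarrow> nat \<Rightarrow> nat \<Rightarrow> complex) \<Rightarrow> complex Matrix.mat" where
  "A a \<equiv> U_mat p P a \<odot> H_mat n d s"

text \<open>The entries of \<open>H_mat\<close> split into a row factor \<open>h\<close> and a
  column factor, which is absorbed here. The block of rank \<open>i\<close> is
  \<open>\<pi> i\<close>.\<close>

definition g :: "(nat \<Rightarrow> nat \<Rightarrow> nat \<Rightarrow> complex) \<Rightarrow> nat \<Rightarrow> nat \<Rightarrow> complex" where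
  "g a i c = U_row p P a (\<pi> i) c * (s $ c) ^ d"

text \<open>For \<open>Suc i < m\<close> this is the coupling of neighbouring levels up to a power
  of the product of all \<open>s $ i\<close>.\<close>

definition weight :: "(nat \<Rightarrow> nat \<Rightarrow> nat \<Rightarrow> complex) \<Rightarrow> nat \<Rightarrow> complex" where
  "weight a i = (\<Sum>t<p ! \<pi> i. a (\<pi> (Suc i)) (\<pi> i) t)"

lemma \<pi>_less: "i < m \<Longrightarrow> \<pi> i < m" and \<sigma>_less: "i < m \<Longrightarrow> \<sigma> i < m"
  using permutes_in_image[OF \<pi>, of i] permutes_in_image[OF permutes_inv[OF \<pi>], of i] by simp_all

lemma \<sigma>_\<pi> [simp]: "\<sigma> (\<pi> i) = i" "\<pi> (\<sigma> i) = i"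
  using permutes_inverses[OF \<pi>] by simp_all

lemma \<sigma>_eq_iff: "\<sigma> j = i \<longleftrightarrow> j = \<pi> i"
  using \<sigma>_\<pi> by metis

lemma m_pos: "0 < m"
  using n_eq n_pos by (cases p) auto

lemma part_pos: "k < m \<Longrightarrow> 0 < p ! k"
  using parts_pos by simp

lemma eta: "j < m \<Longrightarrow> k < m \<Longrightarrow> eta_mat m P $$ (j, k) = (if \<sigma> k < \<sigma> j then 1 else 0)"
  unfolding P_eq by (rule eta_mat_permutation[OF \<pi>])

lemma lev_less: "r < n \<Longrightarrow> lev r < m"
  using block_of_less_length n_eq by (intro \<sigma>_less) simp

lemma lev_surj:
  assumes "i < m"
  shows "\<exists>r<n. lev r = i"
proof -
  let ?r = "block_start p (\<pi> i)"
  have "block_of p ?r = \<pi> i"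
    using \<pi>_less[OF assms] part_pos by (intro block_of_eqI) auto
  moreover have "?r < n"
    using block_end_le[OF \<pi>_less[OF assms]] part_pos[OF \<pi>_less[OF assms]] n_eq by simp
  ultimately show ?thesis
    by (metis \<sigma>_\<pi>(1))
qed

lemma A_index:
  assumes "r < n" "c < n"
  shows "A a $$ (r, c) = h r * g a (lev r) c"
  using assms n_eq U_mat_index[of r p c P a]
  by (simp add: hadamard_def H_mat_def g_def U_mat_def)

lemma A_carrier: "A a \<in> carrier_mat n n"
  by (rule carrier_matI) (simp_all add: hadamard_def U_mat_def n_eq)

text \<open>The product \<open>s $ c * h c\<close> is the same for every column, so up to a constant
  this is a row sum of one block of \<open>U\<close>, which vanishes for Z blocks.\<close>

lemma coupling_sum:
  assumes i: "i < m" and k: "k < m"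
  shows "(\<Sum>c | c < n \<and> lev c = k. g a i c * h c ^ d) =
    (\<Prod>i<n. s $ i) ^ d * (if k < i then \<Sum>t<p ! \<pi> k. a (\<pi> i) (\<pi> k) t else 0)"
proof -
  have "(\<Sum>c | c < n \<and> lev c = k. g a i c * h c ^ d) =
      (\<Sum>c | c < n \<and> block_of p c = \<pi> k. U_row p P a (\<pi> i) c * (\<Prod>i<n. s $ i) ^ d)"
  proof (rule sum.cong)
    fix c assume "c \<in> {c. c < n \<and> block_of p c = \<pi> k}"
    then have "(\<Prod>i<n. s $ i) = s $ c * h c"
      by (intro prod.remove) auto
    then show "g a i c * h c ^ d = U_row p P a (\<pi> i) c * (\<Prod>i<n. s $ i) ^ d"
      by (simp add: g_def power_mult_distrib)
  qed (simp add: \<sigma>_eq_iff)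
  also have "\<dots> = (\<Prod>i<n. s $ i) ^ d * (\<Sum>c | c < sum_list p \<and> block_of p c = \<pi> k. U_row p P a (\<pi> i) c)"
    by (simp add: n_eq sum_distrib_left mult.commute)
  also have "(\<Sum>c | c < sum_list p \<and> block_of p c = \<pi> k. U_row p P a (\<pi> i) c) =
      (if k < i then \<Sum>t<p ! \<pi> k. a (\<pi> i) (\<pi> k) t else 0)"
    using U_row_block_sum[OF \<pi>_less[OF k] part_pos[OF \<pi>_less[OF k]], of P a "\<pi> i"]
      eta[OF \<pi>_less[OF i] \<pi>_less[OF k]] by simp
  finally show ?thesis .
qed

lemma levelled: "levelled_matrix (A a) n m d lev h (g a)"
proof
  show "A a \<in> carrier_mat n n" by (rule A_carrier)
  show "2 \<le> d" by (rule d)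
  show "(\<Sum>c | c < n \<and> lev c = k. g a i c * h c ^ d) = 0" if "i < m" "k < m" "i \<le> k" for i k
    using coupling_sum[OF that(1,2)] that(3) by simp
qed (use A_index lev_less in blast)+

lemma h_nonzero: "(\<forall>i<n. s $ i \<noteq> 0) \<Longrightarrow> h r \<noteq> 0"
  by auto

text \<open>The abstract criterion asks for a nonzero \<open>h r\<close> at the top level,
  \<open>nondegenerate\<close> at the bottom. With one block these coincide; with more, a nonzero
  coupling forces all \<open>s $ i\<close> to be nonzero, so that \<open>h\<close> vanishes
  nowhere.\<close>

lemma newton_order_eq_iff:
  "newton_order (A a) (\<lambda>z. z ^ d) = enat m \<longleftrightarrow>
    (\<exists>r<n. lev r = 0 \<and> h r \<noteq> 0) \<and> (\<exists>c<n. g a 0 c \<noteq> 0) \<and>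
    (2 \<le> m \<longrightarrow> (\<forall>i<n. s $ i \<noteq> 0)) \<and> (\<forall>i. Suc i < m \<longrightarrow> weight a i \<noteq> 0)"
    (is "_ \<longleftrightarrow> ?bot \<and> ?g \<and> ?s \<and> ?w")
proof -
  interpret L: levelled_matrix "A a" n m d lev h "g a" by (rule levelled)
  have coupling: "L.coupling (Suc i) i = (\<Prod>i<n. s $ i) ^ d * weight a i" if "Suc i < m" for i
    unfolding L.coupling_def weight_def using coupling_sum[of "Suc i" i a] that by simp
  have order: "newton_order (A a) (\<lambda>z. z ^ d) = enat m \<longleftrightarrow>
      (\<exists>r<n. Suc (lev r) = m \<and> h r \<noteq> 0) \<and> ?g \<and> (\<forall>i. Suc i < m \<longrightarrow> L.coupling (Suc i) i \<noteq> 0)"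
    by (rule L.newton_order_eq_iff[OF m_pos])
  show ?thesis
  proof (cases "2 \<le> m")
    case False
    then have "m = 1" using m_pos by linarith
    then show ?thesis unfolding order by simp
  next
    case True
    have D: "(\<Prod>i<n. s $ i) ^ d \<noteq> 0 \<longleftrightarrow> (\<forall>i<n. s $ i \<noteq> 0)"
      using d by auto
    have coup: "(\<forall>i. Suc i < m \<longrightarrow> L.coupling (Suc i) i \<noteq> 0) \<longleftrightarrow> (\<forall>i<n. s $ i \<noteq> 0) \<and> ?w"
    proof -
      have "(\<forall>i. Suc i < m \<longrightarrow> L.coupling (Suc i) i \<noteq> 0) \<longleftrightarrow>
          (\<forall>i. Suc i < m \<longrightarrow> (\<Prod>i<n. s $ i) ^ d \<noteq> 0 \<and> weight a i \<noteq> 0)"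
        using coupling by (metis mult_eq_0_iff)
      also have "\<dots> \<longleftrightarrow> (\<Prod>i<n. s $ i) ^ d \<noteq> 0 \<and> ?w"
        using True by (auto dest: spec[of _ 0])
      finally show ?thesis unfolding D .
    qed
    have lev_ex: "\<exists>r<n. lev r = i \<and> h r \<noteq> 0" if "\<forall>i<n. s $ i \<noteq> 0" "i < m" for i
      using lev_surj[OF that(2)] h_nonzero[OF that(1)] by blast
    have "\<exists>r<n. Suc (lev r) = m \<and> h r \<noteq> 0" if "\<forall>i<n. s $ i \<noteq> 0"
      using lev_ex[OF that, of "m - 1"] m_pos by auto
    then show ?thesis
      unfolding order coup using lev_ex[of 0] m_pos True by blast
  qed
qed

text \<open>Translates eta into ranks: a block without predecessors has rank 0, and a row of
  \<open>A\<close> in it is nonzero iff its factor \<open>h\<close> and the bottom form are.\<close>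

lemma nondegenerate_iff:
  "nondegenerate p P d s a \<longleftrightarrow>
    (\<exists>r<n. lev r = 0 \<and> h r \<noteq> 0) \<and> (\<exists>c<n. g a 0 c \<noteq> 0) \<and>
    (2 \<le> m \<longrightarrow> (\<forall>i<n. s $ i \<noteq> 0)) \<and> (\<forall>i. Suc i < m \<longrightarrow> weight a i \<noteq> 0)"
proof -
  have first: "(\<forall>k<m. eta_mat m P $$ (block_of p r, k) = 0) \<and> Matrix.row (A a) r \<noteq> 0\<^sub>v n \<longleftrightarrow>
      lev r = 0 \<and> h r \<noteq> 0 \<and> (\<exists>c<n. g a 0 c \<noteq> 0)" if r: "r < n" for r
  proof -
    have b: "block_of p r < m"
      using block_of_less_length r n_eq by simp
    have "(\<forall>k<m. eta_mat m P $$ (block_of p r, k) = 0) \<longleftrightarrow> (\<forall>k<m. \<not> \<sigma> k < lev r)"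
      using eta[OF b] by auto
    also have "\<dots> \<longleftrightarrow> lev r = 0"
      using \<pi>_less[OF m_pos] by (metis \<sigma>_\<pi>(1) gr0I not_less_zero)
    finally have "(\<forall>k<m. eta_mat m P $$ (block_of p r, k) = 0) \<longleftrightarrow> lev r = 0" .
    moreover have "Matrix.row (A a) r \<noteq> 0\<^sub>v n \<longleftrightarrow> (\<exists>c<n. A a $$ (r, c) \<noteq> 0)"
      using A_carrier[of a] r by (auto simp: vec_eq_iff)
    moreover have "(\<exists>c<n. A a $$ (r, c) \<noteq> 0) \<longleftrightarrow> (\<exists>c<n. h r * g a (lev r) c \<noteq> 0)"
      using A_index[OF r] by metis
    ultimately show ?thesis by auto
  qed
  have last: "(\<forall>j<m. \<forall>k<m. eta_mat m P $$ (j, k) = 1 \<and>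
        \<not> (\<exists>l<m. eta_mat m P $$ (j, l) = 1 \<and> eta_mat m P $$ (l, k) = 1) \<longrightarrow>
        (\<Sum>t<p ! k. a j k t) \<noteq> 0) \<longleftrightarrow> (\<forall>i. Suc i < m \<longrightarrow> weight a i \<noteq> 0)"
  proof -
    \<comment> \<open>Immediate predecessors have rank one less: a larger difference leaves room for
      the block of rank \<open>Suc (\<sigma> k)\<close>.\<close>
    have cover: "eta_mat m P $$ (j, k) = 1 \<and>
        \<not> (\<exists>l<m. eta_mat m P $$ (j, l) = 1 \<and> eta_mat m P $$ (l, k) = 1) \<longleftrightarrow> \<sigma> j = Suc (\<sigma> k)"
      if j: "j < m" and k: "k < m" for j k
    proof -
      have "eta_mat m P $$ (j, l) = 1 \<longleftrightarrow> \<sigma> l < \<sigma> j" "eta_mat m P $$ (l, k) = 1 \<longleftrightarrow> \<sigma> k < \<sigma> l"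
        if "l < m" for l
        using eta[OF j that] eta[OF that k] by auto
      then have "(\<exists>l<m. eta_mat m P $$ (j, l) = 1 \<and> eta_mat m P $$ (l, k) = 1) \<longleftrightarrow>
          (\<exists>l<m. \<sigma> l < \<sigma> j \<and> \<sigma> k < \<sigma> l)"
        by blast
      also have "\<dots> \<longleftrightarrow> Suc (\<sigma> k) < \<sigma> j"
      proof
        assume "Suc (\<sigma> k) < \<sigma> j"
        moreover have "\<pi> (Suc (\<sigma> k)) < m"
          using calculation \<sigma>_less[OF j] by (intro \<pi>_less) simp
        ultimately show "\<exists>l<m. \<sigma> l < \<sigma> j \<and> \<sigma> k < \<sigma> l"
          by (intro exI[of _ "\<pi> (Suc (\<sigma> k))"]) simp
      qed auto
      finally show ?thesis
        using eta[OF j k] by auto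
    qed
    show ?thesis
    proof (intro iffI allI impI)
      fix i assume H: "\<forall>j<m. \<forall>k<m. eta_mat m P $$ (j, k) = 1 \<and>
        \<not> (\<exists>l<m. eta_mat m P $$ (j, l) = 1 \<and> eta_mat m P $$ (l, k) = 1) \<longrightarrow>
        (\<Sum>t<p ! k. a j k t) \<noteq> 0" and i: "Suc i < m"
      then show "weight a i \<noteq> 0"
        using cover[of "\<pi> (Suc i)" "\<pi> i"] \<pi>_less[of i] \<pi>_less[of "Suc i"] by (simp add: weight_def)
    next
      fix j k assume w: "\<forall>i. Suc i < m \<longrightarrow> weight a i \<noteq> 0" and j: "j < m" and k: "k < m"
        and "eta_mat m P $$ (j, k) = 1 \<and>
        \<not> (\<exists>l<m. eta_mat m P $$ (j, l) = 1 \<and> eta_mat m P $$ (l, k) = 1)"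
      then have jk: "\<sigma> j = Suc (\<sigma> k)" using cover by blast
      then have "weight a (\<sigma> k) \<noteq> 0"
        using w \<sigma>_less[OF j] by simp
      then show "(\<Sum>t<p ! k. a j k t) \<noteq> 0"
        unfolding weight_def jk[symmetric] by simp
    qed
  qed
  have "(\<exists>r<n. (\<forall>k<m. eta_mat m P $$ (block_of p r, k) = 0) \<and> Matrix.row (A a) r \<noteq> 0\<^sub>v n) \<longleftrightarrow>
      (\<exists>r<n. lev r = 0 \<and> h r \<noteq> 0 \<and> (\<exists>c<n. g a 0 c \<noteq> 0))"
    by (rule ex_cong1, rule conj_cong[OF refl], rule first)
  then have "nondegenerate p P d s a \<longleftrightarrow>
      (\<exists>r<n. lev r = 0 \<and> h r \<noteq> 0 \<and> (\<exists>c<n. g a 0 c \<noteq> 0)) \<and>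
      (2 \<le> m \<longrightarrow> (\<forall>i<n. s $ i \<noteq> 0)) \<and> (\<forall>i. Suc i < m \<longrightarrow> weight a i \<noteq> 0)"
    unfolding nondegenerate_def Let_def n_eq last by (simp only:)
  also have "(\<exists>r<n. lev r = 0 \<and> h r \<noteq> 0 \<and> (\<exists>c<n. g a 0 c \<noteq> 0)) \<longleftrightarrow>
      (\<exists>r<n. lev r = 0 \<and> h r \<noteq> 0) \<and> (\<exists>c<n. g a 0 c \<noteq> 0)"
    by metis
  finally show ?thesis by (simp only: conj_assoc)
qed

section \<open>Genericity of the maximal order when no entry of \<open>s\<close> vanishes\<close>

lemma newton_order_eq_iff_generic:
  assumes s: "\<forall>i<n. s $ i \<noteq> 0"
  shows "newton_order (A a) (\<lambda>z. z ^ d) = enat m \<longleftrightarrow>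
    (\<exists>c<n. U_row p P a (\<pi> 0) c \<noteq> 0) \<and> (\<forall>i. Suc i < m \<longrightarrow> weight a i \<noteq> 0)"
proof -
  have "\<exists>r<n. lev r = 0 \<and> h r \<noteq> 0"
    using lev_surj[OF m_pos] h_nonzero[OF s] by blast
  moreover have "(\<exists>c<n. g a 0 c \<noteq> 0) \<longleftrightarrow> (\<exists>c<n. U_row p P a (\<pi> 0) c \<noteq> 0)"
    using s by (auto simp: g_def)
  ultimately show ?thesis
    unfolding newton_order_eq_iff using s by blast
qed

lemma open_order:
  assumes s: "\<forall>i<n. s $ i \<noteq> 0"
  shows "open {a. newton_order (A a) (\<lambda>z. z ^ d) = enat m}"
proof -
  have "{a. newton_order (A a) (\<lambda>z. z ^ d) = enat m} =
      (\<Union>c<n. {a. U_row p P a (\<pi> 0) c \<noteq> 0}) \<inter> (\<Inter>i\<in>{..<m - 1}. {a. weight a i \<noteq> 0})"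
    unfolding newton_order_eq_iff_generic[OF s] by (auto simp: less_diff_conv)
  also have "open \<dots>"
    unfolding weight_def
    by (intro open_Int open_UN open_INT ballI open_Collect_neq continuous_on_U_row continuous_on_sum
        continuous_on_const continuous_on_evaluation) (auto simp: n_eq)
  finally show ?thesis .
qed

lemma closure_order:
  assumes s: "\<forall>i<n. s $ i \<noteq> 0" and q: "\<exists>q\<in>set p. q \<noteq> 1"
  shows "closure {a. newton_order (A a) (\<lambda>z. z ^ d) = enat m} = UNIV"
proof -
  let ?O = "{a. newton_order (A a) (\<lambda>z. z ^ d) = enat m}"
  obtain k where k: "k < m" "2 \<le> p ! k"
  proof -
    obtain q where "q \<in> set p" "q \<noteq> 1" using q by blast
    then obtain k where "k < m" "p ! k \<noteq> 1" by (metis in_set_conv_nth)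
    with part_pos[of k] show ?thesis by (intro that[of k]) auto
  qed
  \<comment> \<open>The first column of a block of width at least 2 is a free parameter for Z and S
    alike, so it can make the bottom form nonzero.\<close>
  define c where "c = block_start p k"
  have c: "c < n" "block_of p c = k"
    using k block_end_le[OF k(1)] n_eq by (auto simp: c_def intro!: block_of_eqI)
  have U_row_c: "U_row p P a j c = a j k 0" for a j
  proof -
    have "0 < p ! k" "0 < p ! k - 1" using k(2) by auto
    then show ?thesis by (simp add: U_row_def c(2) B_mat_index c_def[symmetric])
  qed
  have "a \<in> closure ?O" for a
  proof (rule Lim_in_closed_set[OF closed_closure])
    \<comment> \<open>Shifting all parameters by the same \<epsilon> moves each weight affinely,
      with slope the size of its block, and also moves the chosen entry of the bottom form.\<close>
    let ?f = "\<lambda>\<epsilon> j k t. a j k t + \<epsilon>"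
    have "continuous_on UNIV ?f"
      by (intro continuous_on_coordinatewise_then_product continuous_on_add continuous_on_const
          continuous_on_id)
    then have "isCont ?f 0"
      by (simp add: continuous_on_eq_continuous_at)
    then show "(?f \<longlongrightarrow> a) (at 0)"
      by (simp add: isCont_def)
    have "\<forall>\<^sub>F \<epsilon> in at 0. \<forall>i\<in>{..<m - 1}. weight (?f \<epsilon>) i \<noteq> 0"
    proof (rule eventually_ball_finite, safe)
      fix i assume "i < m - 1"
      then have "0 < p ! \<pi> i" by (intro part_pos \<pi>_less) simp
      then have "\<forall>\<^sub>F \<epsilon> in at 0. weight a i + \<epsilon> * of_nat (p ! \<pi> i) \<noteq> 0"
        by (intro eventually_affine_nonzero) simp
      then show "\<forall>\<^sub>F \<epsilon> in at 0. weight (?f \<epsilon>) i \<noteq> 0"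
        by (simp add: weight_def sum.distrib mult.commute)
    qed
    moreover have "\<forall>\<^sub>F \<epsilon> in at 0. a (\<pi> 0) k 0 + \<epsilon> * 1 \<noteq> 0"
      by (rule eventually_affine_nonzero) simp
    ultimately have "\<forall>\<^sub>F \<epsilon> in at 0. ?f \<epsilon> \<in> ?O"
    proof eventually_elim
      case (elim \<epsilon>)
      have "U_row p P (?f \<epsilon>) (\<pi> 0) c \<noteq> 0"
        using elim(2) by (simp add: U_row_c)
      with elim(1) c(1) show ?case
        unfolding mem_Collect_eq newton_order_eq_iff_generic[OF s] by (auto simp: less_diff_conv)
    qed
    then show "\<forall>\<^sub>F \<epsilon> in at 0. ?f \<epsilon> \<in> closure ?O"
      by (rule eventually_mono) (rule subsetD[OF closure_subset])
  qed simp
  then show ?thesis by blast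
qed

end

text \<open>The parameters are arbitrary and special values lower the order, so the order is bounded
  for all \<open>a\<close>, its maximality is characterised, and maximality is shown to be generic.
  If all parts are 1, the bottom form is identically zero and the bound is never attained.\<close>

theorem theorem6p8:
  fixes n d :: nat and p :: "nat list" and P :: "int Matrix.mat" and s :: "complex Matrix.vec"
  assumes "2 \<le> n" and "2 \<le> d"
    and "is_partition p n"
    and "permutation_matrix (length p) P"
    and "s \<in> carrier_vec n"
  defines "A \<equiv> (\<lambda>a. U_mat p P a \<odot> H_mat n d s)" and "\<phi> \<equiv> (\<lambda>z :: complex. z ^ d)"
  shows
    "(\<forall>a. unit_jacobian n (newton_map (A a) \<phi>) \<and>
          polynomially_invertible n (newton_map (A a) \<phi>) \<and>
          newton_order (A a) \<phi> \<le> enat (length p) \<and>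
          inverse_maps n (newton_map (A a) \<phi>) (newton_fin (A a) \<phi>) \<and>
          (newton_order (A a) \<phi> = enat (length p) \<longleftrightarrow> nondegenerate p P d s a)) \<and>
     ((\<exists>q\<in>set p. q \<noteq> 1) \<and> (\<forall>i<n. s $ i \<noteq> 0) \<longrightarrow>
        open {a. newton_order (A a) \<phi> = enat (length p)} \<and>
        closure {a. newton_order (A a) \<phi> = enat (length p)} = UNIV)"
proof -
  obtain \<pi> where \<pi>: "\<pi> permutes {..<length p}"
    "P = Matrix.mat (length p) (length p) (\<lambda>(j, k). if j = \<pi> k then 1 else 0)"
    using assms(4) unfolding permutation_matrix_def by blast
  interpret B: block_map p n d P \<pi> s
    using assms(1-3) \<pi> by unfold_locales (auto simp: is_partition_def)
  have "unit_jacobian n (newton_map (A a) \<phi>) \<and>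
      polynomially_invertible n (newton_map (A a) \<phi>) \<and>
      newton_order (A a) \<phi> \<le> enat (length p) \<and>
      inverse_maps n (newton_map (A a) \<phi>) (newton_fin (A a) \<phi>) \<and>
      (newton_order (A a) \<phi> = enat (length p) \<longleftrightarrow> nondegenerate p P d s a)" for a
  proof -
    interpret L: levelled_matrix "U_mat p P a \<odot> H_mat n d s" n "length p" d B.lev B.h "B.g a"
      by (rule B.levelled)
    show ?thesis
      unfolding A_def \<phi>_def B.nondegenerate_iff B.newton_order_eq_iff
      using L.unit_jacobian L.polynomially_invertible L.inverse_maps_newton_fin
        newton_order_le[OF L.newton_stable_m] by blast
  qed
  moreover have "open {a. newton_order (A a) \<phi> = enat (length p)} \<and>
      closure {a. newton_order (A a) \<phi> = enat (length p)} = UNIV"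
    if "\<exists>q\<in>set p. q \<noteq> 1" "\<forall>i<n. s $ i \<noteq> 0"
    unfolding A_def \<phi>_def using B.open_order[OF that(2)] B.closure_order[OF that(2,1)] by blast
  ultimately show ?thesis by blast
qed

end
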